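(* Let $m\ge4$ be even, let $k$ be a positive integer with $k\ne\frac m2$, put $t=2^k+1$ and assume $t\mid(2^m-1)$. Let $d$ be a positive integer with $d(2^k+1)\equiv2^{\frac m2}+1\pmod{2^m-1}$. Let $\gamma$ be a primitive element of $\mathbb{F}_{2^m}$, let $D=\langle\gamma^t\rangle$ be the subgroup of $\mathbb{F}_{2^m}^*$ generated by $\gamma^t$, let $f(x)=x^d$, and let $\mathcal{C}(f)^{\bar D}=\{(\mathrm{Tr}(ax^d+bx))_{x\in D}:a,b\in\mathbb{F}_{2^m}\}$. Then $\mathcal{C}(f)^{\bar D}$ is a $[\frac{2^m-1}{t},\frac{3m}{2},\frac{2^{m-1}-2^{\frac m2+k-1}}{t}]$ binary code with weight distribution: weight $0$ once; weight $\frac{2^{m-1}+2^{\frac m2-1}}{t}$ with multiplicity $$\frac{2^{3k}(2^{\frac m2}-1)(2^m-2^{m-2k}-2^{m-3k}+2^{\frac m2}-2^{\frac m2-k}+1)}{t^2(2^k-1)};$$ weight $\frac{2^{m-1}-2^{\frac m2+k-1}}{t}$ with multiplicity $$\frac{2^k(2^m-1)(2^{\frac m2}+2^{\frac m2-k}+2^{\frac m2-2k}+1)}{t^2};$$ weight $\frac{2^{m-1}+2^{\frac m2+2k-1}}{t}$ with multiplicity $$\frac{(2^{\frac m2-k}-1)(2^m-1)}{t^2(2^k-1)}.$$ If $k>1$, its dual has parameters $[\frac{2^m-1}{t},\frac{2^m-1}{t}-\frac{3m}{2},3]$. If $k=1$ and $m\ne6$, its dual has parameters $[\frac{2^m-1}{t},\frac{2^m-1}{t}-\frac{3m}{2},4]$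 and is distance-optimal with respect to the sphere packing bound. If $k=1$ and $m=6$, its dual has parameters $[21,12,5]$ and is optimal according to the tables of best codes known (M. Grassl, Bounds on the minimum distance of linear codes and quantum codes, online at http://www.codetables.de).
   Context: $\mathrm{Tr}$ is the absolute trace from $\mathbb{F}_{2^m}$ to $\mathbb{F}_2$. An $[n,k,d]$ binary code is a $k$-dimensional linear subspace of $\mathbb{F}_2^n$ with minimum Hamming distance $d$; the dual is taken with respect to the standard inner product. The multiplicity of a weight is the number of codewords of that weight. An $[n,k,d]$ binary code is distance-optimal (respectively dimension-optimal, length-optimal) if there is no $[n,k,d'\ge d+1]$ (respectively $[n,k'\ge k+1,d]$, $[n'\le n-1,k,d]$) binary linear code. An optimal code is a code that is length-optimal, or dimension-optimal, or distance-optimal, or meets a bound for linear codes. The sphere packing bound states that every $[n,k,d]$ binary code satisfies $2^n\ge 2^k\sum_{i=0}^{\lfloor (d-1)/2\rfloor}\binom ni$; "distance-optimal with respect to the sphere packing bound" means distance-optimal, with this bound being the one used to establish it. The notation $\mathcal{C}(f)^{\bar D}$ indicates puncturing the code $\{(\mathrm{Tr}(af(x)+bx))_{x\in\mathbb{F}_{2^m}^*}:a,b\in\mathbb{F}_{2^m}\}$ on the coordinates in $\bar D=\mathbb{F}_{2^m}^*\setminus D$. *)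

theory Defs
  imports
    "HOL-Library.Z2"
    "HOL-Library.Cardinality"
    "HOL-Library.Function_Algebras"
    "HOL-Computational_Algebra.Primes"
    "HOL-Number_Theory.Cong"
    Complex_Main
begin

text \<open>
  The field with two elements is the type \<^typ>\<open>bit\<close>. A binary word with coordinates indexed by
  a set \<open>I\<close> is a function \<open>'i \<Rightarrow> bit\<close> that vanishes outside \<open>I\<close>; taking \<open>I = {..<n}\<close> gives
  the space of binary words of length \<open>n\<close>, and taking for \<open>I\<close> a subset of a field gives words whose
  coordinates are field elements.
\<close>

definition words :: "'i set \<Rightarrow> ('i \<Rightarrow> bit) set" where
  "words I = {v. \<forall>i. i \<notin> I \<longrightarrow> v i = 0}"

definition word_scale :: "bit \<Rightarrow> ('i \<Rightarrow> bit) \<Rightarrow> ('i \<Rightarrow> bit)" where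
  "word_scale c v = (\<lambda>i. c * v i)"

interpretation word: vector_space "word_scale :: bit \<Rightarrow> ('i \<Rightarrow> bit) \<Rightarrow> ('i \<Rightarrow> bit)"
  by unfold_locales (simp_all only: word_scale_def fun_eq_iff plus_fun_apply distrib_left distrib_right mult.assoc mult_1_left, simp_all)

definition weight :: "('i \<Rightarrow> bit) \<Rightarrow> nat" where
  "weight v = card {i. v i \<noteq> 0}"

definition hamming_dist :: "('i \<Rightarrow> bit) \<Rightarrow> ('i \<Rightarrow> bit) \<Rightarrow> nat" where
  "hamming_dist u v = card {i. u i \<noteq> v i}"

text \<open>
  A relation rather than a function, because a code with a single codeword has no minimum distance.
\<close>

definition has_min_dist :: "('i \<Rightarrow> bit) set \<Rightarrow> nat \<Rightarrow> bool" where
  "has_min_dist C d \<longleftrightarrow>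
     (\<exists>u\<in>C. \<exists>v\<in>C. u \<noteq> v \<and> hamming_dist u v = d) \<and>
     (\<forall>u\<in>C. \<forall>v\<in>C. u \<noteq> v \<longrightarrow> d \<le> hamming_dist u v)"

text \<open>\<open>C\<close> is an \<open>[n, k, d]\<close> binary linear code on the coordinate set \<open>I\<close>.\<close>

definition binary_code :: "'i set \<Rightarrow> nat \<Rightarrow> nat \<Rightarrow> nat \<Rightarrow> ('i \<Rightarrow> bit) set \<Rightarrow> bool" where
  "binary_code I n k d C \<longleftrightarrow>
     finite I \<and> card I = n \<and> C \<subseteq> words I \<and> word.subspace C \<and> word.dim C = k \<and> has_min_dist C d"

definition dual_code :: "'i set \<Rightarrow> ('i \<Rightarrow> bit) set \<Rightarrow> ('i \<Rightarrow> bit) set" where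
  "dual_code I C = {v \<in> words I. \<forall>u\<in>C. (\<Sum>i\<in>I. u i * v i) = 0}"

text \<open>
  The argument \<open>w\<close> is real so that weights given as quotients can be used without rounding.
\<close>

definition weight_multiplicity :: "('i \<Rightarrow> bit) set \<Rightarrow> real \<Rightarrow> nat" where
  "weight_multiplicity C w = card {c \<in> C. real (weight c) = w}"

definition distance_optimal :: "nat \<Rightarrow> nat \<Rightarrow> nat \<Rightarrow> bool" where
  "distance_optimal n k d \<longleftrightarrow>
     (\<nexists>d' (C :: (nat \<Rightarrow> bit) set). d' \<ge> d + 1 \<and> binary_code {..<n} n k d' C)"

definition sphere_packing_bound :: "nat \<Rightarrow> nat \<Rightarrow> nat \<Rightarrow> bool" where
  "sphere_packing_bound n k d \<longleftrightarrow> 2 ^ n \<ge> 2 ^ k * (\<Sum>i = 0..(d - 1) div 2. n choose i)"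

text \<open>
  Distance-optimal, and no larger distance is compatible with the sphere packing bound.
\<close>

definition distance_optimal_sphere_packing :: "nat \<Rightarrow> nat \<Rightarrow> nat \<Rightarrow> bool" where
  "distance_optimal_sphere_packing n k d \<longleftrightarrow>
     distance_optimal n k d \<and> (\<forall>d' \<ge> d + 1. \<not> sphere_packing_bound n k d')"

text \<open>
  The absolute trace of the field with \<open>2 ^ m\<close> elements. The sum of the conjugates lies in the
  prime field \<open>{0, 1}\<close>; the conditional only identifies that subset with \<^typ>\<open>bit\<close>, as
  \<open>of_bit_abs_trace\<close> confirms.
\<close>

definition abs_trace :: "nat \<Rightarrow> 'a::finite_field \<Rightarrow> bit" where
  "abs_trace m x = (if (\<Sum>i<m. x ^ (2 ^ i)) = 0 then 0 else 1)"

lemma of_bit_abs_trace: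
  fixes x :: "'a::finite_field"
  assumes "CARD('a) = 2 ^ m"
  shows "of_bit (abs_trace m x) = (\<Sum>i<m. x ^ (2 ^ i))"
proof -
  let ?s = "\<Sum>i<m. x ^ (2 ^ i)"
  have "(2::'a) = 0"
  proof -
    have "card {0, 1 :: 'a} \<le> CARD('a)" by (rule card_mono) auto
    then have "m \<noteq> 0" using assms by (intro notI) simp
    then have "even CARD('a)" using assms by simp
    then have "(-1 :: 'a) = 1"
      using finite_field_power_card_eq_same[of "-1 :: 'a"] by simp
    then have "1 + 1 = (0::'a)" by (metis add.right_inverse)
    then show ?thesis by simp
  qed
  then have sq: "(a + b)\<^sup>2 = a\<^sup>2 + b\<^sup>2" for a b :: 'a
    by (simp add: power2_sum)
  have "(\<Sum>i<l. x ^ (2 ^ i))\<^sup>2 = (\<Sum>i<l. x ^ (2 ^ Suc i))" for l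
    by (induction l) (simp_all add: sq flip: power_mult, simp add: mult.commute)
  then have "?s\<^sup>2 = (\<Sum>i<m. x ^ (2 ^ Suc i))" .
  also have "\<dots> + x = (\<Sum>i<Suc m. x ^ (2 ^ i))"
    by (subst sum.lessThan_Suc_shift) simp
  also have "\<dots> = ?s + x"
    using finite_field_power_card_eq_same[of x] assms by simp
  finally have "?s\<^sup>2 = ?s" by simp
  then have "?s = 0 \<or> ?s = 1" by (auto simp: power2_eq_square)
  then show ?thesis by (auto simp: abs_trace_def)
qed

text \<open>
  For \<open>g = 0\<close> this set contains \<open>1\<close> and \<open>0\<close>, so \<open>0\<close> is never a primitive element.
\<close>

definition cyclic_subgroup :: "'a::field \<Rightarrow> 'a set" where
  "cyclic_subgroup g = range (\<lambda>i::int. g powi i)"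

definition primitive_element :: "'a::field \<Rightarrow> bool" where
  "primitive_element g \<longleftrightarrow> cyclic_subgroup g = UNIV - {0}"

text \<open>
  The code of all words \<open>(Tr (a f(x) + b x))\<close> with \<open>x\<close> ranging over \<open>D\<close>. For \<open>D = UNIV - {0}\<close> this
  is the full code, and a smaller \<open>D\<close> gives its puncturing on the coordinates outside \<open>D\<close>.
\<close>

definition trace_code :: "nat \<Rightarrow> ('a::finite_field \<Rightarrow> 'a) \<Rightarrow> 'a set \<Rightarrow> ('a \<Rightarrow> bit) set" where
  "trace_code m f D =
     {(\<lambda>x. if x \<in> D then abs_trace m (a * f x + b * x) else 0) | a b. True}"

end

theory Submission
  imports Defs "HOL-Computational_Algebra.Polynomial" "HOL-Library.Product_Plus"
begin

text \<open>
  Write \<open>h = m / 2\<close>. The hypotheses give \<open>t dvd 2 ^ h + 1\<close>, so \<open>h / k\<close> is odd. Substituting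
  \<open>x = y ^ t\<close> turns the weight of a codeword into the exponential sum \<open>S\<close> of the quadratic form
  \<open>Tr (a y ^ (2 ^ h + 1) + b y ^ (2 ^ k + 1))\<close>. The form is the trace of a Hermitian form over
  the field of order \<open>4 ^ k\<close>, and its radical is the kernel of a second-order equation in a
  generator of the Galois group over that field, so it has order \<open>1\<close>, \<open>4 ^ k\<close> or \<open>4 ^ (2 k)\<close>.
  This determines \<open>S\<^sup>2\<close>, and \<open>S = 1\<close> modulo \<open>t\<close> fixes the sign. The multiplicities follow from
  the first three power moments.

  A dual word is a set of elements of \<open>D\<close> with vanishing sum and vanishing sum of \<open>d\<close>-th powers.
  Distance-optimality comes from the sphere packing bound, except for length 21, where a code with
  parameters \<open>[21, 12, 6]\<close> is excluded by finding low-weight dual words and shortening at them.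
\<close>

section \<open>Binary words and codes\<close>

text \<open>Reducing the congruence for \<open>d\<close> modulo \<open>t\<close>, a divisor of
  \<open>2 ^ m - 1\<close>, gives \<open>t dvd 2 ^ h + 1\<close>; then \<open>k \<noteq> h\<close>
  forces \<open>h / k\<close> to be at least 3. As \<open>h / k\<close> is odd,
  \<open>y \<mapsto> y ^ (2 ^ h)\<close> acts on the field of order \<open>4 ^ k\<close> as
  conjugation over the field of order \<open>2 ^ k\<close>. This makes both exponents,
  \<open>2 ^ h + 1\<close> and \<open>2 ^ k + 1\<close>, Hermitian, and it makes the form vanish on
  its own radical, so that the square of \<open>S\<close> is \<open>2 ^ m\<close> times the order of
  the radical and not 0. The sign can be read off because \<open>2 ^ k\<close> and
  \<open>2 ^ h\<close> are both -1 modulo \<open>t\<close> and \<open>t \<ge> 3\<close>.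

  The moments are known in advance because distinct nonzero coordinates leave no dual words of
  weight 1 or 2.

  For \<open>k = 1\<close> no dual word of minimum weight is exhibited: algebra or a fourth moment
  bounds the distance from below, and the nonexistence result that proves optimality bounds it from
  above. Length 21 is exceptional since 1 + 21 + 210 = 232 is at most \<open>2 ^ 9\<close>, so
  sphere packing admits distance 6 there.\<close>

declare add_bit_eq_xor [simp del] mult_bit_eq_and [simp del]

lemma bit_add_self [simp]: "(b::bit) + b = 0"
  by (cases b) (simp_all add: add_bit_eq_xor)

lemma bit_minus_eq_plus: "(a::bit) - b = a + b"
  by (cases a; cases b) simp_all

lemma bit_add_eq_0_iff: "(a::bit) + b = 0 \<longleftrightarrow> a = b"
  by (cases a; cases b) simp_all

lemma word_add_self [simp]: "(u::'i \<Rightarrow> bit) + u = 0"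
  by (simp add: fun_eq_iff)

lemma word_minus_eq_plus: "(u::'i \<Rightarrow> bit) - v = u + v"
  by (simp add: fun_eq_iff bit_minus_eq_plus)

lemma word_add_eq_0_iff: "(u::'i \<Rightarrow> bit) + v = 0 \<longleftrightarrow> u = v"
  by (simp add: fun_eq_iff bit_add_eq_0_iff)

section \<open>Additive characters and additive maps on finite sets\<close>

definition chi :: "bit \<Rightarrow> int" where
  "chi b = (if b = 0 then 1 else - 1)"

lemma chi_0 [simp]: "chi 0 = 1" and chi_1 [simp]: "chi 1 = - 1"
  by (simp_all add: chi_def)

lemma chi_add: "chi (a + b) = chi a * chi b"
  by (cases a; cases b) simp_all

lemma finite_add_closed_translate:
  fixes G :: "'b::ab_group_add set"
  assumes "finite G" "\<And>x y. x \<in> G \<Longrightarrow> y \<in> G \<Longrightarrow> x + y \<in> G" "g \<in> G"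
  shows "bij_betw (\<lambda>x. g + x) G G"
proof -
  have "inj_on (\<lambda>x. g + x) G" by (simp add: inj_on_def)
  moreover have "(\<lambda>x. g + x) ` G \<subseteq> G" using assms by auto
  ultimately show ?thesis
    using endo_inj_surj[OF assms(1)] by (simp add: bij_betw_def)
qed

text \<open>Orthogonality of characters: translating by an element where \<open>f\<close> is 1
  permutes \<open>G\<close> and negates the sum.\<close>

lemma sum_chi_additive:
  fixes f :: "'b::ab_group_add \<Rightarrow> bit"
  assumes "finite G" "\<And>x y. x \<in> G \<Longrightarrow> y \<in> G \<Longrightarrow> x + y \<in> G"
    and "\<And>x y. x \<in> G \<Longrightarrow> y \<in> G \<Longrightarrow> f (x + y) = f x + f y"
  shows "(\<Sum>x\<in>G. chi (f x)) = (if \<forall>x\<in>G. f x = 0 then int (card G) else 0)"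
proof (cases "\<forall>x\<in>G. f x = 0")
  case False
  then obtain g where g: "g \<in> G" "f g = 1" by auto
  have "(\<Sum>x\<in>G. chi (f x)) = (\<Sum>x\<in>G. chi (f (g + x)))"
    using finite_add_closed_translate[OF assms(1,2) g(1)] by (intro sum.reindex_bij_betw[symmetric])
  also have "\<dots> = - (\<Sum>x\<in>G. chi (f x))"
    using g assms(3) by (simp add: chi_add sum_negf)
  finally have "(\<Sum>x\<in>G. chi (f x)) = 0" by linarith
  then show ?thesis using False by (simp only: if_False)
qed simp

text \<open>Every nonempty fibre is a translate of the kernel. Closure under addition is enough for
  this, because translations of a finite closed set are bijective and so supply the
  inverses.\<close>

lemma card_eq_kernel_image:
  fixes f :: "'b::ab_group_add \<Rightarrow> 'c::ab_group_add"
  assumes "finite G" "\<And>x y. x \<in> G \<Longrightarrow> y \<in> G \<Longrightarrow> x + y \<in> G"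
    and add: "\<And>x y. x \<in> G \<Longrightarrow> y \<in> G \<Longrightarrow> f (x + y) = f x + f y"
  shows "card G = card {x\<in>G. f x = 0} * card (f ` G)"
proof -
  have fibre: "card {x\<in>G. f x = y} = card {x\<in>G. f x = 0}" if y: "y \<in> f ` G" for y
  proof -
    obtain g where g: "g \<in> G" "y = f g" using y by blast
    have G: "(\<lambda>x. g + x) ` G = G"
      using finite_add_closed_translate[OF assms(1,2) g(1)] by (simp add: bij_betw_def)
    have "{x\<in>G. f x = y} = (\<lambda>x. g + x) ` {x\<in>G. f x = 0}"
    proof
      show "(\<lambda>x. g + x) ` {x\<in>G. f x = 0} \<subseteq> {x\<in>G. f x = y}"
        using g assms(2) add by auto
      show "{x\<in>G. f x = y} \<subseteq> (\<lambda>x. g + x) ` {x\<in>G. f x = 0}"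
      proof
        fix x assume x: "x \<in> {x\<in>G. f x = y}"
        then obtain z where z: "z \<in> G" "x = g + z" using G by blast
        then have "f z = 0" using x g add by simp
        then show "x \<in> (\<lambda>x. g + x) ` {x\<in>G. f x = 0}" using z by blast
      qed
    qed
    then show ?thesis by (simp add: card_image inj_on_def)
  qed
  have "card G = (\<Sum>x\<in>G. 1)" by simp
  also have "\<dots> = (\<Sum>y\<in>f ` G. card {x\<in>G. f x = y} * 1)"
    using sum_fun_comp[of G "f ` G" f "\<lambda>_. 1::nat"] assms(1) by simp
  also have "\<dots> = (\<Sum>y\<in>f ` G. card {x\<in>G. f x = 0})"
    using fibre by (intro sum.cong) auto
  finally show ?thesis by (simp add: mult.commute)
qed

section \<open>Words, dimension and duality\<close>

lemma words_add [simp]: "u \<in> words I \<Longrightarrow> v \<in> words I \<Longrightarrow> u + v \<in> words I"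
  by (simp add: words_def)

lemma zero_in_words [simp]: "0 \<in> words I"
  by (simp add: words_def)

lemma bij_betw_support_words: "bij_betw (\<lambda>v. {i. v i \<noteq> 0}) (words I) (Pow I)"
proof (rule bij_betw_byWitness[where f' = "\<lambda>X i. if i \<in> X then 1 else 0"])
  show "\<forall>a\<in>words I. (\<lambda>i. if i \<in> {i. a i \<noteq> 0} then 1 else 0) = a"
    by (auto simp: fun_eq_iff)
qed (auto simp: words_def)

lemma finite_words [simp]: "finite I \<Longrightarrow> finite (words I)"
  using bij_betw_finite[OF bij_betw_support_words] by auto

lemma card_words: "finite I \<Longrightarrow> card (words I) = 2 ^ card I"
  using bij_betw_same_card[OF bij_betw_support_words, of I] by (simp add: card_Pow)

lemma subspace_word_iff:
  "word.subspace C \<longleftrightarrow> 0 \<in> C \<and> (\<forall>u\<in>C. \<forall>v\<in>C. u + v \<in> C)"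
proof
  assume C: "0 \<in> C \<and> (\<forall>u\<in>C. \<forall>v\<in>C. u + v \<in> C)"
  have "word_scale c u \<in> C" if "u \<in> C" for c u
    using that C by (cases c) (simp_all add: word_scale_def zero_fun_def)
  then show "word.subspace C" using C by (auto simp: word.subspace_def)
qed (auto simp: word.subspace_def)

lemma card_span_word:
  assumes "finite B" "word.independent B"
  shows "card (word.span B) = 2 ^ card B"
proof -
  let ?f = "\<lambda>u. \<Sum>b\<in>B. word_scale (u b) b"
  have "word.span B = ?f ` words B"
  proof
    show "word.span B \<subseteq> ?f ` words B"
    proof
      fix x assume "x \<in> word.span B"
      then obtain u where u: "x = ?f u" using word.span_finite[OF assms(1)] by auto
      have "x = ?f (\<lambda>b. if b \<in> B then u b else 0)" unfolding u by (intro sum.cong) auto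
      moreover have "(\<lambda>b. if b \<in> B then u b else 0) \<in> words B" by (simp add: words_def)
      ultimately show "x \<in> ?f ` words B" by (rule image_eqI)
    qed
    show "?f ` words B \<subseteq> word.span B" using word.span_finite[OF assms(1)] by auto
  qed
  moreover have "inj_on ?f (words B)"
  proof (rule inj_onI)
    fix u v assume uv: "u \<in> words B" "v \<in> words B" "?f u = ?f v"
    have "(\<Sum>b\<in>B. word_scale (u b + v b) b) = ?f u + ?f v"
      by (simp only: word.scale_left_distrib sum.distrib)
    then have "(\<Sum>b\<in>B. word_scale (u b + v b) b) = 0"
      using uv(3) by simp
    then have "u b + v b = 0" if "b \<in> B" for b
      using word.independentD[OF assms(2,1) subset_refl, of "\<lambda>b. u b + v b"] that by blast
    then show "u = v" using uv(1,2) by (fastforce simp: words_def fun_eq_iff bit_add_eq_0_iff)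
  qed
  ultimately show ?thesis by (simp add: card_image card_words assms(1))
qed

lemma card_subspace_word:
  assumes "finite C" "word.subspace C"
  shows "card C = 2 ^ word.dim C"
proof -
  obtain B where B: "B \<subseteq> C" "word.independent B" "C \<subseteq> word.span B" "card B = word.dim C"
    using word.basis_exists by blast
  have "C = word.span B"
    using B assms(2) word.span_minimal by blast
  then show ?thesis
    using card_span_word[OF finite_subset[OF B(1) assms(1)] B(2)] B(4) by simp
qed

text \<open>Shortening a code only bounds its size from below; this cuts the result down to an exact
  power of two.\<close>

lemma subspace_word_of_card:
  assumes "finite C" "word.subspace C" "2 ^ j \<le> card C"
  obtains C' where "C' \<subseteq> C" "word.subspace C'" "card C' = 2 ^ j"
proof -
  obtain B where B: "B \<subseteq> C" "word.independent B" "C \<subseteq> word.span B" "card B = word.dim C"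
    using word.basis_exists by blast
  have "j \<le> card B" using assms card_subspace_word[OF assms(1,2)] B(4) by simp
  then obtain B' where B': "B' \<subseteq> B" "card B' = j" by (meson obtain_subset_with_card_n)
  have "finite B'" using B' B assms(1) finite_subset by metis
  moreover have "word.independent B'" using B(2) B'(1) word.independent_mono by blast
  moreover have "word.span B' \<subseteq> C"
    using B'(1) B(1) assms(2) word.span_minimal by (meson order_trans)
  ultimately show ?thesis using that card_span_word B'(2) word.subspace_span by metis
qed

abbreviation inner :: "'i set \<Rightarrow> ('i \<Rightarrow> bit) \<Rightarrow> ('i \<Rightarrow> bit) \<Rightarrow> bit" where
  "inner I u v \<equiv> \<Sum>i\<in>I. u i * v i"

lemma inner_single:
  assumes "finite I" "i \<in> I"
  shows "inner I u (\<lambda>j. if j = i then 1 else 0) = u i"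
  using assms by (simp add: if_distrib cong: if_cong)

lemma subspace_dual_code: "word.subspace (dual_code I C)"
  by (simp add: subspace_word_iff dual_code_def distrib_left sum.distrib)

lemma dual_code_subset_words: "dual_code I C \<subseteq> words I"
  by (auto simp: dual_code_def)

text \<open>Double counting of the sum of \<open>chi (inner I u v)\<close>: summing over
  \<open>u\<close> first detects the dual words \<open>v\<close>, summing over \<open>v\<close>
  first leaves only \<open>u = 0\<close>.\<close>

lemma card_dual_code:
  assumes "finite I" "C \<subseteq> words I" "word.subspace C"
  shows "card C * card (dual_code I C) = 2 ^ card I"
proof -
  have fin: "finite C" using assms finite_subset finite_words by blast
  have C: "\<And>x y. x \<in> C \<Longrightarrow> y \<in> C \<Longrightarrow> x + y \<in> C" "0 \<in> C"
    using assms(3) by (auto simp: subspace_word_iff)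
  have "(\<Sum>v\<in>words I. \<Sum>u\<in>C. chi (inner I u v)) =
      (\<Sum>v\<in>words I. if v \<in> dual_code I C then int (card C) else 0)"
  proof (rule sum.cong)
    fix v assume v: "v \<in> words I"
    show "(\<Sum>u\<in>C. chi (inner I u v)) = (if v \<in> dual_code I C then int (card C) else 0)"
      using sum_chi_additive[OF fin C(1), of "\<lambda>u. inner I u v"] v
      by (simp add: distrib_right sum.distrib dual_code_def)
  qed simp
  also have "\<dots> = int (card C * card (dual_code I C))"
    using assms(1) dual_code_subset_words[of I C]
    by (simp add: sum.If_cases Int_absorb1)
  finally have *: "(\<Sum>v\<in>words I. \<Sum>u\<in>C. chi (inner I u v)) = int (card C * card (dual_code I C))" .
  have "(\<Sum>v\<in>words I. \<Sum>u\<in>C. chi (inner I u v)) = (\<Sum>u\<in>C. \<Sum>v\<in>words I. chi (inner I u v))"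
    by (rule sum.swap)
  also have "\<dots> = (\<Sum>u\<in>C. if u = 0 then 2 ^ card I else 0)"
  proof (rule sum.cong)
    fix u assume u: "u \<in> C"
    have "(\<forall>v\<in>words I. inner I u v = 0) \<longleftrightarrow> u = 0"
    proof
      assume a: "\<forall>v\<in>words I. inner I u v = 0"
      show "u = 0"
      proof
        fix i show "u i = 0 i"
        proof (cases "i \<in> I")
          case True
          then show ?thesis
            using a inner_single[OF assms(1) True, of u] by (simp add: words_def)
        qed (use u assms(2) in \<open>auto simp: words_def\<close>)
      qed
    qed simp
    then show "(\<Sum>v\<in>words I. chi (inner I u v)) = (if u = 0 then 2 ^ card I else 0)"
      using sum_chi_additive[of "words I" "\<lambda>v. inner I u v"] assms(1)
      by (simp add: distrib_left sum.distrib card_words)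
  qed simp
  also have "\<dots> = 2 ^ card I" using fin C(2) by (simp add: sum.delta)
  finally have "int (card C * card (dual_code I C)) = int (2 ^ card I)"
    unfolding * by simp
  then show ?thesis by (simp only: of_nat_eq_iff)
qed

lemma dual_code_dual_code:
  assumes "finite I" "C \<subseteq> words I" "word.subspace C"
  shows "dual_code I (dual_code I C) = C"
proof (rule sym, rule card_subset_eq)
  show "finite (dual_code I (dual_code I C))"
    by (rule finite_subset[OF dual_code_subset_words finite_words[OF assms(1)]])
  show "C \<subseteq> dual_code I (dual_code I C)"
    using assms(2) by (auto simp: dual_code_def mult.commute)
  have "card (dual_code I C) * card C = card (dual_code I C) * card (dual_code I (dual_code I C))"
    using card_dual_code[OF assms] card_dual_code[OF assms(1) dual_code_subset_words subspace_dual_code]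
    by (simp add: mult.commute)
  moreover have "card (dual_code I C) \<noteq> 0"
    using card_dual_code[OF assms] by (metis mult_0_right power_not_zero zero_neq_numeral)
  ultimately show "card C = card (dual_code I (dual_code I C))" by simp
qed

section \<open>Weight, minimum distance and sphere packing\<close>

lemma hamming_dist_eq_weight: "hamming_dist u v = weight (u + v)"
proof -
  have "(u i \<noteq> v i) = ((u + v) i \<noteq> 0)" for i
    by (cases "u i"; cases "v i") simp_all
  then show ?thesis by (simp add: hamming_dist_def weight_def)
qed

lemma has_min_dist_subspace:
  assumes "word.subspace C"
  shows "has_min_dist C \<delta> \<longleftrightarrow>
    (\<exists>c\<in>C. c \<noteq> 0 \<and> weight c = \<delta>) \<and> (\<forall>c\<in>C. c \<noteq> 0 \<longrightarrow> \<delta> \<le> weight c)"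
proof -
  have C: "\<And>x y. x \<in> C \<Longrightarrow> y \<in> C \<Longrightarrow> x + y \<in> C" "0 \<in> C"
    using assms by (auto simp: subspace_word_iff)
  show ?thesis
  proof (intro iffI conjI)
    assume l: "has_min_dist C \<delta>"
    then obtain u v where "u \<in> C" "v \<in> C" "u \<noteq> v" "weight (u + v) = \<delta>"
      by (auto simp: has_min_dist_def hamming_dist_eq_weight)
    then show "\<exists>c\<in>C. c \<noteq> 0 \<and> weight c = \<delta>" using C(1) word_add_eq_0_iff by blast
    show "\<forall>c\<in>C. c \<noteq> 0 \<longrightarrow> \<delta> \<le> weight c"
    proof (intro ballI impI)
      fix c assume "c \<in> C" "c \<noteq> 0"
      then have "\<delta> \<le> hamming_dist c 0" using l C(2) by (simp add: has_min_dist_def)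
      then show "\<delta> \<le> weight c" by (simp add: hamming_dist_eq_weight)
    qed
  next
    assume r: "(\<exists>c\<in>C. c \<noteq> 0 \<and> weight c = \<delta>) \<and> (\<forall>c\<in>C. c \<noteq> 0 \<longrightarrow> \<delta> \<le> weight c)"
    then obtain c where c: "c \<in> C" "c \<noteq> 0" "weight c = \<delta>" by blast
    have "\<exists>u\<in>C. \<exists>v\<in>C. u \<noteq> v \<and> hamming_dist u v = \<delta>"
      by (rule bexI[OF _ c(1)], rule bexI[OF _ C(2)]) (use c in \<open>simp add: hamming_dist_eq_weight\<close>)
    moreover have "\<delta> \<le> hamming_dist u v" if "u \<in> C" "v \<in> C" "u \<noteq> v" for u v
      using r C(1)[OF that(1,2)] that(3) word_add_eq_0_iff[of u v] by (simp add: hamming_dist_eq_weight)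
    ultimately show "has_min_dist C \<delta>" by (simp add: has_min_dist_def)
  qed
qed

lemma weight_eq_0_iff: "finite I \<Longrightarrow> v \<in> words I \<Longrightarrow> weight v = 0 \<longleftrightarrow> v = 0"
proof -
  assume "finite I" "v \<in> words I"
  then have "finite {i. v i \<noteq> 0}" unfolding words_def by (auto elim!: finite_subset[rotated])
  then show ?thesis by (auto simp: weight_def fun_eq_iff)
qed

lemma weight_add_le:
  assumes "finite I" "u \<in> words I" "v \<in> words I"
  shows "weight (u + v) \<le> weight u + weight v"
proof -
  have "{i. (u + v) i \<noteq> 0} \<subseteq> {i. u i \<noteq> 0} \<union> {i. v i \<noteq> 0}" by auto
  moreover have "finite ({i. u i \<noteq> 0} \<union> {i. v i \<noteq> 0})"
    by (rule finite_subset[OF _ assms(1)]) (use assms in \<open>auto simp: words_def\<close>)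
  ultimately show ?thesis
    unfolding weight_def by (meson card_mono card_Un_le order_trans)
qed

lemma exists_min_dist:
  assumes "word.subspace C" "C \<noteq> {0}"
  shows "\<exists>\<delta>. has_min_dist C \<delta>"
proof -
  have ex: "\<exists>c. c \<in> C \<and> c \<noteq> 0" using assms by (auto simp: subspace_word_iff)
  let ?P = "\<lambda>c. c \<in> C \<and> c \<noteq> 0"
  obtain c where "?P c" "\<forall>c'. ?P c' \<longrightarrow> weight c \<le> weight c'"
    using ex_has_least_nat[of ?P _ weight] ex by blast
  then show ?thesis using has_min_dist_subspace[OF assms(1)] by blast
qed

lemma card_words_weight_le:
  assumes "finite I"
  shows "card {v\<in>words I. weight v \<le> e} = (\<Sum>i=0..e. card I choose i)"
proof -
  have "bij_betw (\<lambda>v. {i. v i \<noteq> 0}) {v\<in>words I. weight v \<le> e} {X\<in>Pow I. card X \<le> e}"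
  proof (rule bij_betw_subset[OF bij_betw_support_words])
    have "(\<lambda>v. {i. v i \<noteq> 0}) ` {v\<in>words I. weight v \<le> e} =
        {X \<in> (\<lambda>v. {i. v i \<noteq> 0}) ` words I. card X \<le> e}"
      by (auto simp: weight_def)
    then show "(\<lambda>v. {i. v i \<noteq> 0}) ` {v\<in>words I. weight v \<le> e} = {X\<in>Pow I. card X \<le> e}"
      by (simp only: bij_betw_imp_surj_on[OF bij_betw_support_words])
  qed auto
  then have "card {v\<in>words I. weight v \<le> e} = card {X\<in>Pow I. card X \<le> e}"
    by (rule bij_betw_same_card)
  also have "{X\<in>Pow I. card X \<le> e} = (\<Union>i\<in>{0..e}. {X. X \<subseteq> I \<and> card X = i})" by auto
  also have "card \<dots> = (\<Sum>i=0..e. card {X. X \<subseteq> I \<and> card X = i})"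
    using assms by (intro card_UN_disjoint) auto
  finally show ?thesis using n_subsets[OF assms] by simp
qed

text \<open>Disjointness of the balls around the codewords is expressed as injectivity of
  \<open>(c, v) \<mapsto> c + v\<close>, with \<open>v\<close> ranging over the ball around
  0.\<close>

lemma sphere_packing_boundI:
  assumes "binary_code I n k \<delta> C"
  shows "sphere_packing_bound n k \<delta>"
proof -
  have I: "finite I" "card I = n" and C: "C \<subseteq> words I" "word.subspace C" "word.dim C = k"
    and min: "has_min_dist C \<delta>" using assms by (auto simp: binary_code_def)
  have fin: "finite C" using C I finite_subset finite_words by blast
  define B where "B = {v\<in>words I. weight v \<le> (\<delta> - 1) div 2}"
  \<comment> \<open>For \<open>\<delta> = 0\<close> the subtraction in
    \<open>(\<delta> - 1) div 2\<close> would truncate, and twice the radius would not be below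
    \<open>\<delta>\<close>.\<close>
  have "\<delta> \<noteq> 0"
    using min[unfolded has_min_dist_subspace[OF C(2)]] C(1) weight_eq_0_iff[OF I(1)] by fastforce
  have "inj_on (\<lambda>(c, v). c + v) (C \<times> B)"
  proof (rule inj_onI, clarsimp)
    fix c v c' v' assume a: "c \<in> C" "v \<in> B" "c' \<in> C" "v' \<in> B" "c + v = c' + v'"
    have "c - c' = v' - v" using a(5) by (metis add_diff_cancel_left' add_diff_cancel_right' diff_add_eq_diff_diff_swap diff_diff_eq2)
    then have e: "c + c' = v' + v" by (simp only: word_minus_eq_plus)
    have "weight (v' + v) \<le> weight v' + weight v"
      using a weight_add_le[OF I(1)] by (simp add: B_def)
    also have "\<dots> < \<delta>" using a(2,4) \<open>\<delta> \<noteq> 0\<close> unfolding B_def by (clarsimp, linarith)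
    finally have "weight (c + c') < \<delta>" using e by simp
    moreover have "c + c' \<in> C" using C(2) a by (simp add: subspace_word_iff)
    ultimately have "c + c' = 0"
      using min[unfolded has_min_dist_subspace[OF C(2)]] by fastforce
    then have "c = c'" by (metis word_minus_eq_plus eq_iff_diff_eq_0)
    then show "c = c' \<and> v = v'" using a(5) by simp
  qed
  moreover have "(\<lambda>(c, v). c + v) ` (C \<times> B) \<subseteq> words I"
    using C(1) by (auto simp: B_def intro!: words_add)
  ultimately have "card (C \<times> B) \<le> card (words I)"
    using I(1) by (intro card_inj_on_le) auto
  then show ?thesis
    using card_words_weight_le[OF I(1), of "(\<delta> - 1) div 2"] card_subspace_word[OF fin C(2)] C(3) I
    by (simp add: sphere_packing_bound_def card_cartesian_product card_words B_def)
qed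

section \<open>Power moments through character sums\<close>

lemma sum_chi_word:
  assumes "finite I" "u \<in> words I"
  shows "(\<Sum>i\<in>I. chi (u i)) = int (card I) - 2 * int (weight u)"
proof -
  have s: "{i. u i \<noteq> 0} = {i\<in>I. u i \<noteq> 0}" using assms(2) by (auto simp: words_def)
  have "(\<Sum>i\<in>I. chi (u i)) = (\<Sum>i\<in>I. 1 - 2 * of_bool (u i \<noteq> 0))"
    by (intro sum.cong) (auto simp: chi_def)
  also have "\<dots> = int (card I) - 2 * int (card {i\<in>I. u i \<noteq> 0})"
    using assms(1) by (simp add: sum_subtractf flip: sum_distrib_left) (simp add: Int_def)
  finally show ?thesis by (simp only: weight_def s)
qed

lemma sum_word_eq_of_nat_weight:
  assumes "finite I" "u \<in> words I"
  shows "(\<Sum>i\<in>I. u i) = of_nat (weight u)"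
proof -
  have s: "{i. u i \<noteq> 0} = {i\<in>I. u i \<noteq> 0}" using assms(2) by (auto simp: words_def)
  have "(\<Sum>i\<in>I. u i) = (\<Sum>i\<in>I. of_bool (u i \<noteq> 0))"
    by (intro sum.cong) auto
  also have "\<dots> = of_nat (card {i\<in>I. u i \<noteq> 0})"
    using assms(1) by (simp add: Int_def)
  finally show ?thesis by (simp only: weight_def s)
qed

context
  fixes I :: "'i set" and C :: "('i \<Rightarrow> bit) set"
  assumes fin: "finite I" "finite C" and closed: "\<And>u v. u \<in> C \<Longrightarrow> v \<in> C \<Longrightarrow> u + v \<in> C"
begin

lemma sum_chi_coordinate:
  "(\<Sum>u\<in>C. chi (u i)) = (if \<forall>u\<in>C. u i = 0 then int (card C) else 0)"
  using sum_chi_additive[OF fin(2) closed, of "\<lambda>u. u i"] by simp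

text \<open>The hypothesis excludes dual words of weight 1, so every coordinate is a nontrivial
  character on \<open>C\<close> and sums to 0.\<close>

lemma first_moment:
  assumes "\<And>i. i \<in> I \<Longrightarrow> \<exists>u\<in>C. u i \<noteq> 0"
  shows "(\<Sum>u\<in>C. \<Sum>i\<in>I. chi (u i)) = 0"
proof -
  have "(\<Sum>u\<in>C. \<Sum>i\<in>I. chi (u i)) = (\<Sum>i\<in>I. \<Sum>u\<in>C. chi (u i))" by (rule sum.swap)
  also have "\<dots> = 0"
  proof (rule sum.neutral, rule ballI)
    fix i assume "i \<in> I"
    then have "\<not> (\<forall>u\<in>C. u i = 0)" using assms by blast
    then show "(\<Sum>u\<in>C. chi (u i)) = 0" by (simp only: sum_chi_coordinate if_False)
  qed
  finally show ?thesis .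
qed

text \<open>The square expands over pairs of coordinates. The hypothesis excludes dual words of
  weight 2, so only the diagonal pairs survive.\<close>

lemma second_moment:
  assumes "\<And>i j. i \<in> I \<Longrightarrow> j \<in> I \<Longrightarrow> i \<noteq> j \<Longrightarrow> \<exists>u\<in>C. u i \<noteq> u j"
  shows "(\<Sum>u\<in>C. (\<Sum>i\<in>I. chi (u i))\<^sup>2) = int (card C) * int (card I)"
proof -
  have "(\<Sum>u\<in>C. (\<Sum>i\<in>I. chi (u i))\<^sup>2) = (\<Sum>u\<in>C. \<Sum>i\<in>I. \<Sum>j\<in>I. chi (u i + u j))"
    by (simp add: power2_eq_square sum_product chi_add)
  also have "\<dots> = (\<Sum>i\<in>I. \<Sum>u\<in>C. \<Sum>j\<in>I. chi (u i + u j))" by (rule sum.swap)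
  also have "\<dots> = (\<Sum>i\<in>I. \<Sum>j\<in>I. \<Sum>u\<in>C. chi (u i + u j))" by (subst (2) sum.swap) simp
  also have "\<dots> = (\<Sum>i\<in>I. \<Sum>j\<in>I. if j = i then int (card C) else 0)"
  proof (intro sum.cong refl)
    fix i j assume "i \<in> I" "j \<in> I"
    then have "(\<forall>u\<in>C. u i + u j = 0) \<longleftrightarrow> j = i"
      using assms[of i j] by (auto simp: bit_add_eq_0_iff)
    then show "(\<Sum>u\<in>C. chi (u i + u j)) = (if j = i then int (card C) else 0)"
      using sum_chi_additive[OF fin(2) closed, of "\<lambda>u. u i + u j"] by (simp add: ac_simps)
  qed
  finally show ?thesis using fin(1) by (simp add: mult.commute)
qed

text \<open>The fourth power expands over ordered quadruples, and orthogonality keeps those whose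
  coordinates sum to 0 on all of \<open>C\<close>. Quadruples that do not cancel in pairs come from
  dual words of weight 2 or 4.\<close>

lemma fourth_moment:
  "(\<Sum>u\<in>C. (\<Sum>i\<in>I. chi (u i)) ^ 4) =
    int (card C) * int (card {(i, j, k, l). {i, j, k, l} \<subseteq> I \<and> (\<forall>u\<in>C. u i + u j + u k + u l = 0)})"
proof -
  let ?J = "I \<times> I \<times> I \<times> I"
  have "(\<Sum>u\<in>C. (\<Sum>i\<in>I. chi (u i)) ^ 4) =
      (\<Sum>u\<in>C. \<Sum>(i, j, k, l)\<in>?J. chi (u i + u j + u k + u l))"
  proof (rule sum.cong)
    fix u :: "'i \<Rightarrow> bit"
    let ?f = "\<lambda>i. chi (u i)"
    have "(\<Sum>i\<in>I. ?f i) ^ 4 = (\<Sum>i\<in>I. ?f i) * ((\<Sum>j\<in>I. ?f j) * ((\<Sum>k\<in>I. ?f k) * (\<Sum>l\<in>I. ?f l)))"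
      by (simp add: power4_eq_xxxx mult.assoc)
    also have "\<dots> = (\<Sum>i\<in>I. \<Sum>j\<in>I. \<Sum>k\<in>I. \<Sum>l\<in>I. ?f i * (?f j * (?f k * ?f l)))"
      by (simp only: sum_distrib_right) (simp only: sum_distrib_left)
    also have "\<dots> = (\<Sum>(i, j, k, l)\<in>?J. chi (u i + u j + u k + u l))"
      by (simp add: sum.cartesian_product chi_add mult.assoc split_def)
    finally show "(\<Sum>i\<in>I. ?f i) ^ 4 = (\<Sum>(i, j, k, l)\<in>?J. chi (u i + u j + u k + u l))" .
  qed simp
  also have "\<dots> = (\<Sum>(i, j, k, l)\<in>?J. \<Sum>u\<in>C. chi (u i + u j + u k + u l))"
    by (subst sum.swap) (simp add: split_def)
  also have "\<dots> = (\<Sum>p\<in>?J. if p \<in> {(i, j, k, l). \<forall>u\<in>C. u i + u j + u k + u l = 0}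
      then int (card C) else 0)"
  proof (rule sum.cong)
    fix p assume "p \<in> ?J"
    obtain i j k l where p: "p = (i, j, k, l)" by (cases p)
    show "(case p of (i, j, k, l) \<Rightarrow> \<Sum>u\<in>C. chi (u i + u j + u k + u l)) =
        (if p \<in> {(i, j, k, l). \<forall>u\<in>C. u i + u j + u k + u l = 0} then int (card C) else 0)"
      using sum_chi_additive[OF fin(2) closed, of "\<lambda>u. u i + u j + u k + u l"] by (simp add: p ac_simps)
  qed simp
  also have "\<dots> = int (card C) * int (card (?J \<inter> {(i, j, k, l). \<forall>u\<in>C. u i + u j + u k + u l = 0}))"
    using fin(1) by (simp add: sum.If_cases mult.commute)
  also have "?J \<inter> {(i, j, k, l). \<forall>u\<in>C. u i + u j + u k + u l = 0} =
      {(i, j, k, l). {i, j, k, l} \<subseteq> I \<and> (\<forall>u\<in>C. u i + u j + u k + u l = 0)}" by auto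
  finally show ?thesis .
qed

end

definition paired :: "'i set \<Rightarrow> ('i \<times> 'i \<times> 'i \<times> 'i) set" where
  "paired I = {(i, j, k, l). {i, j, k, l} \<subseteq> I \<and> (i = j \<and> k = l \<or> i = k \<and> j = l \<or> i = l \<and> j = k)}"

lemma card_paired:
  assumes "finite I"
  shows "int (card (paired I)) = 3 * (int (card I))\<^sup>2 - 2 * int (card I)"
proof -
  let ?S = "\<lambda>i j. {(k, l). {i, j, k, l} \<subseteq> I \<and> (i = j \<and> k = l \<or> i = k \<and> j = l \<or> i = l \<and> j = k)}"
  have "paired I = Sigma I (\<lambda>i. Sigma I (\<lambda>j. ?S i j))" by (auto simp: paired_def)
  moreover have S: "card (?S i j) = (if j = i then card I else 2)" "finite (?S i j)" if "i \<in> I" "j \<in> I" for i j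
  proof -
    have "?S i j = (if j = i then (\<lambda>k. (k, k)) ` I else {(i, j), (j, i)})" using that by auto
    then show "card (?S i j) = (if j = i then card I else 2)" "finite (?S i j)"
      using assms by (auto simp: card_image inj_on_def)
  qed
  ultimately have "card (paired I) = (\<Sum>i\<in>I. \<Sum>j\<in>I. card (?S i j))"
    using assms by (simp add: card_SigmaI)
  also have "\<dots> = (\<Sum>i\<in>I. \<Sum>j\<in>I. if j = i then card I else 2)" using S by simp
  finally have "int (card (paired I)) = (\<Sum>i\<in>I. \<Sum>j\<in>I. if j = i then int (card I) else 2)" by (simp add: if_distrib cong: if_cong)
  also have "\<dots> = (\<Sum>i\<in>I. \<Sum>j\<in>I. 2 + (if j = i then int (card I) - 2 else 0))" by (intro sum.cong) auto
  also have "\<dots> = 3 * (int (card I))\<^sup>2 - 2 * int (card I)"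
    using assms by (simp add: sum.distrib power2_eq_square algebra_simps)
  finally show ?thesis .
qed

section \<open>Nonexistence of a binary [21, 12, 6] code\<close>

text \<open>Converts a relation between coordinates of a code into a word of its dual, to which a
  bound on the dual weights applies.\<close>

definition unit_word :: "'i \<Rightarrow> 'i \<Rightarrow> bit" where
  "unit_word i = (\<lambda>j. if j = i then 1 else 0)"

lemma unit_word_in_words [simp]: "i \<in> I \<Longrightarrow> unit_word i \<in> words I"
  by (simp add: unit_word_def words_def)

lemma inner_unit_word: "finite I \<Longrightarrow> i \<in> I \<Longrightarrow> inner I u (unit_word i) = u i"
  using inner_single[of I i u] by (simp add: unit_word_def)

lemma weight_unit_word [simp]: "weight (unit_word i) = 1"
  by (simp add: unit_word_def weight_def)

lemma unit_word_inj: "unit_word i = unit_word j \<longleftrightarrow> i = j"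
  by (metis unit_word_def zero_neq_one)

lemma sum_unit_words_eq_0:
  assumes "unit_word i + unit_word j + unit_word k + unit_word l = 0"
  shows "i = j \<and> k = l \<or> i = k \<and> j = l \<or> i = l \<and> j = k"
proof -
  consider "i = j" | "i = k" | "i = l" | "i \<noteq> j" "i \<noteq> k" "i \<noteq> l" by blast
  then show ?thesis
  proof cases
    case 1
    then show ?thesis using assms by (simp add: word_add_eq_0_iff unit_word_inj)
  next
    case 2
    have "unit_word i + unit_word j + unit_word i + unit_word l =
        (unit_word i + unit_word i) + (unit_word j + unit_word l)"
      by (simp only: ac_simps)
    then have "unit_word j + unit_word l = 0" using assms 2 by simp
    then show ?thesis using 2 by (simp add: word_add_eq_0_iff unit_word_inj)
  next
    case 3
    have "unit_word i + unit_word j + unit_word k + unit_word i =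
        (unit_word i + unit_word i) + (unit_word j + unit_word k)"
      by (simp only: ac_simps)
    then have "unit_word j + unit_word k = 0" using assms 3 by simp
    then show ?thesis using 3 by (simp add: word_add_eq_0_iff unit_word_inj)
  next
    case 4
    then have "(unit_word i + unit_word j + unit_word k + unit_word l) i = 1"
      by (simp add: unit_word_def)
    then show ?thesis using assms by simp
  qed
qed

lemma fourth_moment_paired:
  assumes "finite I" "finite C" "\<And>u v. u \<in> C \<Longrightarrow> v \<in> C \<Longrightarrow> u + v \<in> C"
    and "\<And>i j k l. {i, j, k, l} \<subseteq> I \<Longrightarrow> \<forall>u\<in>C. u i + u j + u k + u l = 0 \<Longrightarrow>
      i = j \<and> k = l \<or> i = k \<and> j = l \<or> i = l \<and> j = k"
  shows "(\<Sum>u\<in>C. (\<Sum>i\<in>I. chi (u i)) ^ 4) = int (card C) * (3 * (int (card I))\<^sup>2 - 2 * int (card I))"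
proof -
  have triv: "u i + u j + u k + u l = 0"
    if "i = j \<and> k = l \<or> i = k \<and> j = l \<or> i = l \<and> j = k" for u :: "'a \<Rightarrow> bit" and i j k l
    using that by (cases "u i"; cases "u j"; cases "u k"; cases "u l") auto
  have "({i, j, k, l} \<subseteq> I \<and> (\<forall>u\<in>C. u i + u j + u k + u l = 0)) =
      ({i, j, k, l} \<subseteq> I \<and> (i = j \<and> k = l \<or> i = k \<and> j = l \<or> i = l \<and> j = k))" for i j k l
    using assms(4)[of i j k l] triv[of i j k l] by blast
  then have "{(i, j, k, l). {i, j, k, l} \<subseteq> I \<and> (\<forall>u\<in>C. u i + u j + u k + u l = 0)} = paired I"
    by (simp only: paired_def)
  then show ?thesis using fourth_moment[OF assms(1-3)] card_paired[OF assms(1)] by simp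
qed

text \<open>A linear programming argument. The dual of \<open>dual_code I E\<close> is
  \<open>E\<close>, which has no nonzero word of weight below 6, so the second and fourth moments of
  \<open>dual_code I E\<close> are forced. They determine the sum of
  \<open>(F\<^sup>2 - \<alpha>) * (F\<^sup>2 - \<beta>)\<close> with
  \<open>F = n - 2 * weight\<close>. By \<open>ineq\<close> this sum exceeds what 0 and the all-one
  word contribute, so some other word has a positive term. The parameters are chosen so that the
  term is not positive for weights near \<open>n / 2\<close>.\<close>

lemma exists_low_weight_dual_word:
  fixes \<alpha> \<beta> :: int
  assumes I: "finite I" "card I = n" "n > 0"
    and E: "E \<subseteq> words I" "word.subspace E" "card E = 2 ^ j" "j \<le> n"
    and even: "\<And>c. c \<in> E \<Longrightarrow> even (weight c)"
    and min: "\<And>c. c \<in> E \<Longrightarrow> c \<noteq> 0 \<Longrightarrow> 6 \<le> weight c"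
    and ineq: "2 * (((int n)\<^sup>2 - \<alpha>) * ((int n)\<^sup>2 - \<beta>)) <
      2 ^ (n - j) * (3 * (int n)\<^sup>2 - 2 * int n - (\<alpha> + \<beta>) * int n + \<alpha> * \<beta>)"
  obtains u where "u \<in> dual_code I E" "u \<noteq> 0" "2 * weight u \<le> n"
    "0 < ((int n - 2 * int (weight u))\<^sup>2 - \<alpha>) * ((int n - 2 * int (weight u))\<^sup>2 - \<beta>)"
proof -
  define D where "D = dual_code I E"
  define F where "F u = (\<Sum>i\<in>I. chi (u i))" for u :: "'a \<Rightarrow> bit"
  define one :: "'a \<Rightarrow> bit" where "one = (\<lambda>i. if i \<in> I then 1 else 0)"
  have D: "D \<subseteq> words I" "word.subspace D" "finite D" "0 \<in> D"
    and D_add: "\<And>u v. u \<in> D \<Longrightarrow> v \<in> D \<Longrightarrow> u + v \<in> D"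
    using subspace_dual_code[of I E] dual_code_subset_words[of I E] finite_words[OF I(1)]
    by (auto simp: D_def subspace_word_iff intro: finite_subset)
  have "2 ^ j * card D = 2 ^ (n - j) * 2 ^ j"
    using card_dual_code[OF I(1) E(1,2)] E(3,4) I(2) by (simp add: D_def flip: power_add)
  then have cardD: "card D = 2 ^ (n - j)" by simp
  have FD: "F u = int n - 2 * int (weight u)" if "u \<in> D" for u
    using sum_chi_word[OF I(1)] that D(1) I(2) by (auto simp: F_def)
  \<comment> \<open>Biduality: a word orthogonal to all of \<open>D\<close> lies in
    \<open>E\<close>, where only 0 has weight below 6.\<close>
  have sep: "x = 0" if "x \<in> words I" "weight x < 6" "\<And>u. u \<in> D \<Longrightarrow> inner I u x = 0" for x
  proof -
    have "x \<in> dual_code I D" using that by (simp add: dual_code_def)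
    then have "x \<in> E" using dual_code_dual_code[OF I(1) E(1,2)] by (simp add: D_def)
    then show ?thesis using min that(2) by fastforce
  qed
  have w4: "weight (unit_word i + unit_word j + unit_word k + unit_word l) < 6"
    if "{i, j, k, l} \<subseteq> I" for i j k l :: 'a
    using that weight_add_le[OF I(1), of "unit_word i" "unit_word j"]
      weight_add_le[OF I(1), of "unit_word i + unit_word j" "unit_word k"]
      weight_add_le[OF I(1), of "unit_word i + unit_word j + unit_word k" "unit_word l"] by simp
  have M4: "(\<Sum>u\<in>D. F u ^ 4) = 2 ^ (n - j) * (3 * (int n)\<^sup>2 - 2 * int n)"
  proof -
    have "i = j \<and> k = l \<or> i = k \<and> j = l \<or> i = l \<and> j = k"
      if "{i, j, k, l} \<subseteq> I" "\<forall>u\<in>D. u i + u j + u k + u l = 0" for i j k l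
    proof (rule sum_unit_words_eq_0, rule sep)
      show "inner I u (unit_word i + unit_word j + unit_word k + unit_word l) = 0" if "u \<in> D" for u
        using that \<open>\<forall>u\<in>D. _ u\<close> \<open>{i, j, k, l} \<subseteq> I\<close> I(1)
        by (simp add: distrib_left sum.distrib inner_unit_word)
    qed (use that w4 in auto)
    then show ?thesis
      using fourth_moment_paired[OF I(1) D(3) D_add] cardD I(2) by (simp add: F_def)
  qed
  have M2: "(\<Sum>u\<in>D. (F u)\<^sup>2) = 2 ^ (n - j) * int n"
  proof -
    have "\<exists>u\<in>D. u i \<noteq> u j" if ij: "i \<in> I" "j \<in> I" "i \<noteq> j" for i j
    proof (rule ccontr)
      assume a: "\<not> (\<exists>u\<in>D. u i \<noteq> u j)"
      have "unit_word i + unit_word j = 0"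
      proof (rule sep)
        show "weight (unit_word i + unit_word j) < 6"
          using ij weight_add_le[OF I(1), of "unit_word i" "unit_word j"] by simp
        show "inner I u (unit_word i + unit_word j) = 0" if "u \<in> D" for u
          using that a ij I(1) by (simp add: distrib_left sum.distrib inner_unit_word bit_add_eq_0_iff)
      qed (use ij in auto)
      then show False using ij by (simp add: word_add_eq_0_iff unit_word_inj)
    qed
    then show ?thesis
      using second_moment[OF I(1) D(3) D_add] cardD I(2) by (simp add: F_def)
  qed
  define g where "g u = ((F u)\<^sup>2 - \<alpha>) * ((F u)\<^sup>2 - \<beta>)" for u
  have g: "g u = F u ^ 4 - (\<alpha> + \<beta>) * (F u)\<^sup>2 + \<alpha> * \<beta>" for u
    by (simp add: g_def algebra_simps power4_eq_xxxx power2_eq_square)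
  have "(\<Sum>u\<in>D. g u) = (\<Sum>u\<in>D. F u ^ 4) - (\<alpha> + \<beta>) * (\<Sum>u\<in>D. (F u)\<^sup>2) + int (card D) * (\<alpha> * \<beta>)"
    unfolding g by (simp add: sum.distrib sum_subtractf sum_distrib_left)
  also have "\<dots> = 2 ^ (n - j) * (3 * (int n)\<^sup>2 - 2 * int n - (\<alpha> + \<beta>) * int n + \<alpha> * \<beta>)"
    unfolding M4 M2 cardD by (simp add: algebra_simps)
  finally have sum_g: "(\<Sum>u\<in>D. g u) > 2 * (((int n)\<^sup>2 - \<alpha>) * ((int n)\<^sup>2 - \<beta>))"
    using ineq by simp
  \<comment> \<open>The inner product with the all-one word is the parity of the weight.\<close>
  have one_D: "one \<in> D"
  proof -
    have "inner I u one = 0" if "u \<in> E" for u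
    proof -
      have "inner I u one = (\<Sum>i\<in>I. u i)" by (intro sum.cong) (auto simp: one_def)
      also have "\<dots> = 0"
        using sum_word_eq_of_nat_weight[OF I(1), of u] that E(1) even[OF that] by (auto elim!: evenE)
      finally show ?thesis .
    qed
    then show ?thesis by (simp add: D_def dual_code_def words_def one_def)
  qed
  have F_one: "F (u + one) = - F u" for u
    unfolding F_def by (simp add: one_def chi_add sum_negf[symmetric] del: sum_negf)
  have F0: "F 0 = int n" by (simp add: F_def I(2))
  have g0: "g 0 = ((int n)\<^sup>2 - \<alpha>) * ((int n)\<^sup>2 - \<beta>)" "g one = g 0"
    using F_one[of 0] by (simp_all add: g_def F0)
  have "one \<noteq> 0" using F_one[of 0] F0 I(3) by auto
  have "(\<Sum>u\<in>D. g u) = g 0 + (g one + (\<Sum>u\<in>D - {0} - {one}. g u))"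
    using D(3,4) one_D \<open>one \<noteq> 0\<close> by (simp add: sum.remove)
  then have "(\<Sum>u\<in>D - {0} - {one}. g u) > 0" using sum_g g0 by linarith
  then obtain u where u: "u \<in> D" "u \<noteq> 0" "u \<noteq> one" "g u > 0"
    using sum_nonpos[of "D - {0} - {one}" g] by (metis Diff_iff insertI1 linorder_not_less)
  \<comment> \<open>Adding the all-one word negates \<open>F\<close> and preserves \<open>g\<close>,
    so the weight may be taken to be at most \<open>n / 2\<close>.\<close>
  have "\<exists>v\<in>D. v \<noteq> 0 \<and> g v > 0 \<and> F v \<ge> 0"
  proof (cases "F u \<ge> 0")
    case False
    then have "F (u + one) \<ge> 0" "g (u + one) = g u" by (simp_all add: F_one g_def)
    moreover have "u + one \<noteq> 0" using u(3) by (simp add: word_add_eq_0_iff)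
    ultimately show ?thesis using u D_add one_D by metis
  qed (use u in blast)
  then show ?thesis
    using that FD unfolding g_def D_def by fastforce
qed

text \<open>Restriction to \<open>U\<close> maps \<open>E\<close> into the words on \<open>U\<close>
  orthogonal to \<open>u\<close>, a hyperplane since \<open>u\<close> is supported in
  \<open>U\<close>. Vanishing on \<open>U\<close> therefore costs one dimension less than the number
  of coordinates.\<close>

lemma card_subcode_vanishing:
  assumes I: "finite I" and E: "E \<subseteq> words I" "word.subspace E"
    and u: "u \<in> dual_code I E" "u \<noteq> 0" and U: "{i. u i \<noteq> 0} \<subseteq> U" "U \<subseteq> I"
  shows "card E \<le> card {c\<in>E. \<forall>i\<in>U. c i = 0} * 2 ^ (card U - 1)"
proof -
  have finU: "finite U" using U(2) I finite_subset by blast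
  have fin: "finite E" using E I finite_subset finite_words by blast
  define r where "r c = (\<lambda>i. if i \<in> U then c i else 0)" for c :: "'a \<Rightarrow> bit"
  have "u i = 0" if "i \<notin> U" for i using U(1) that by auto
  then have uU: "u \<in> words U" by (simp add: words_def)
  have sub: "word.subspace {0, u}" by (simp add: subspace_word_iff)
  have "card {0, u} = 2" using u(2) by auto
  then have "2 * card (dual_code U {0, u}) = 2 ^ card U"
    using card_dual_code[OF finU _ sub] uU by simp
  moreover have "U \<noteq> {}" using uU u(2) by (auto simp: words_def fun_eq_iff)
  then have "card U \<noteq> 0" using finU by simp
  ultimately have card_dual: "card (dual_code U {0, u}) = 2 ^ (card U - 1)"
    by (cases "card U") auto
  have "r ` E \<subseteq> dual_code U {0, u}"
  proof (rule image_subsetI)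
    fix c assume c: "c \<in> E"
    have "inner U u (r c) = inner I c u"
    proof -
      have "inner I c u = inner U c u"
        using U uU I by (intro sum.mono_neutral_right) (auto simp: words_def)
      also have "\<dots> = inner U u (r c)" by (intro sum.cong) (auto simp: r_def mult.commute)
      finally show ?thesis by simp
    qed
    also have "\<dots> = 0" using u(1) c by (simp add: dual_code_def)
    finally show "r c \<in> dual_code U {0, u}" by (simp add: dual_code_def words_def r_def)
  qed
  then have "card (r ` E) \<le> 2 ^ (card U - 1)"
    unfolding card_dual[symmetric]
    by (intro card_mono finite_subset[OF dual_code_subset_words finite_words[OF finU]])
  moreover have "card E = card {c\<in>E. r c = 0} * card (r ` E)"
    using E(2) by (intro card_eq_kernel_image fin) (auto simp: subspace_word_iff r_def fun_eq_iff)
  moreover have "{c\<in>E. r c = 0} = {c\<in>E. \<forall>i\<in>U. c i = 0}" by (auto simp: r_def fun_eq_iff)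
  ultimately show ?thesis by simp
qed

text \<open>The support of \<open>u\<close> is enlarged to exactly \<open>p + 1\<close> coordinates,
  so that the resulting length does not depend on the weight of \<open>u\<close>.\<close>

lemma shorten_at_dual_word:
  assumes I: "finite I" and E: "E \<subseteq> words I" "word.subspace E" "2 ^ (j + p) \<le> card E"
    and u: "u \<in> dual_code I E" "u \<noteq> 0" "weight u \<le> Suc p" "Suc p \<le> card I"
  obtains J E' where "J \<subseteq> I" "card J = card I - Suc p" "E' \<subseteq> E" "E' \<subseteq> words J"
    "word.subspace E'" "card E' = 2 ^ j"
proof -
  have "{i. u i \<noteq> 0} \<subseteq> I" using u(1) by (auto simp: dual_code_def words_def)
  then obtain U where U: "{i. u i \<noteq> 0} \<subseteq> U" "U \<subseteq> I" "card U = Suc p"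
    using exists_subset_between[of "{i. u i \<noteq> 0}" "Suc p" I] u I by (auto simp: weight_def)
  let ?E = "{c\<in>E. \<forall>i\<in>U. c i = 0}"
  have "2 ^ j * 2 ^ p \<le> card ?E * 2 ^ p"
    using card_subcode_vanishing[OF I E(1,2) u(1,2) U(1,2)] E(3) unfolding U(3) power_add diff_Suc_1 by linarith
  then have "2 ^ j \<le> card ?E" by (rule mult_right_le_imp_le) simp
  moreover have "finite ?E" using E(1) I finite_subset finite_words by fastforce
  moreover have "word.subspace ?E" using E(2) by (auto simp: subspace_word_iff)
  ultimately obtain E' where E': "E' \<subseteq> ?E" "word.subspace E'" "card E' = 2 ^ j"
    by (elim subspace_word_of_card[rotated 2]) auto
  have "E' \<subseteq> words (I - U)" using E'(1) E(1) by (auto simp: words_def)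
  moreover have "card (I - U) = card I - Suc p"
    using card_Diff_subset[OF finite_subset[OF U(2) I] U(2)] U(3) by simp
  ultimately show ?thesis using that[of "I - U" E'] E' by blast
qed

text \<open>At each coordinate the character sum over \<open>C\<close> is 0 or
  \<open>card C\<close>, hence nonnegative; summed over the coordinates, this says that the average
  weight is at most half the length.\<close>

lemma plotkin:
  assumes "finite I" "C \<subseteq> words I" "word.subspace C" "\<And>c. c \<in> C \<Longrightarrow> c \<noteq> 0 \<Longrightarrow> \<delta> \<le> weight c"
  shows "2 * \<delta> * (card C - 1) \<le> card I * card C"
proof -
  have fin: "finite C" using assms finite_subset finite_words by blast
  have C: "\<And>u v. u \<in> C \<Longrightarrow> v \<in> C \<Longrightarrow> u + v \<in> C" "0 \<in> C"
    using assms(3) by (auto simp: subspace_word_iff)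
  have "0 \<le> (\<Sum>i\<in>I. \<Sum>u\<in>C. chi (u i))"
    by (rule sum_nonneg) (simp add: sum_chi_coordinate[OF assms(1) fin C(1)])
  also have "\<dots> = (\<Sum>u\<in>C. int (card I) - 2 * int (weight u))"
    using assms(2) by (subst sum.swap) (auto intro!: sum.cong sum_chi_word assms(1))
  also have "\<dots> = int (card I) * int (card C) - 2 * (\<Sum>u\<in>C. int (weight u))"
    by (simp add: sum_subtractf sum_distrib_left)
  also have "(\<Sum>u\<in>C. int (weight u)) = int (weight (0 :: 'a \<Rightarrow> bit)) + (\<Sum>u\<in>C - {0}. int (weight u))"
    by (rule sum.remove[OF fin C(2)])
  finally have "2 * (\<Sum>u\<in>C - {0}. int (weight u)) \<le> int (card I) * int (card C)"
    by (simp add: weight_def)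
  moreover have "int \<delta> * int (card C - 1) \<le> (\<Sum>u\<in>C - {0}. int (weight u))"
    using sum_mono[of "C - {0}" "\<lambda>_. int \<delta>" "\<lambda>u. int (weight u)"] assms(4) C(2) fin
    by (simp add: mult.commute)
  ultimately have "int (2 * \<delta> * (card C - 1)) \<le> int (card I * card C)"
    by simp
  then show ?thesis by (simp only: of_nat_le_iff)
qed

lemma square_le_imp_weight_le:
  fixes n w b :: nat
  assumes "2 * w \<le> n" "(int b)\<^sup>2 < (int n - 2 * int w)\<^sup>2"
  shows "2 * w + b < n"
proof -
  have "int b < int n - 2 * int w" using assms by (intro power2_less_imp_less[OF assms(2)]) auto
  then show ?thesis by linarith
qed

text \<open>
  The dual word of weight at most 7 produced by the fourth moment shortens the code to length 14,
  the next one, of weight at most 4, to length 10, where the Plotkin bound is violated.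
\<close>

lemma no_even_code_21_12_6:
  assumes I: "finite I" "card I = 21"
    and E: "E \<subseteq> words I" "word.subspace E" "card E = 2 ^ 12"
    and even: "\<And>c. c \<in> E \<Longrightarrow> even (weight c)"
    and min: "\<And>c. c \<in> E \<Longrightarrow> c \<noteq> 0 \<Longrightarrow> 6 \<le> weight c"
  shows False
proof -
  \<comment> \<open>Here \<open>F\<close> is odd, and the term is not positive when \<open>F\<close>
    is 1, 3 or 5 in absolute value. So \<open>F\<close> is at least 7, which means weight at most 7.
    The inequality reads 366080 < 389120.\<close>
  obtain u where u: "u \<in> dual_code I E" "u \<noteq> 0" "2 * weight u \<le> 21"
    "0 < ((int 21 - 2 * int (weight u))\<^sup>2 - 1) * ((int 21 - 2 * int (weight u))\<^sup>2 - 25)"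
    by (rule exists_low_weight_dual_word[OF I _ E _ even min, where \<alpha> = 1 and \<beta> = 25])
      (auto simp: power2_eq_square)
  have "(int 21 - 2 * int (weight u))\<^sup>2 \<ge> 1"
  proof -
    have "int 21 - 2 * int (weight u) \<noteq> 0" by presburger
    then show ?thesis by (metis int_one_le_iff_zero_less zero_less_power2)
  qed
  then have "(int 5)\<^sup>2 < (int 21 - 2 * int (weight u))\<^sup>2"
    using u(4) by (simp add: zero_less_mult_iff)
  then have "weight u \<le> Suc 6" using square_le_imp_weight_le[OF u(3)] by fastforce
  then obtain J E1 where E1: "J \<subseteq> I" "card J = 14" "E1 \<subseteq> E" "E1 \<subseteq> words J"
    "word.subspace E1" "card E1 = 2 ^ 6"
    using shorten_at_dual_word[OF I(1) E(1,2), of 6 6 u] u(1,2) E(3) I(2) by auto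
  have J: "finite J" using E1(1) I(1) finite_subset by blast
  \<comment> \<open>Now \<open>F\<close> is even, and the term is not positive when \<open>F\<close>
    is 0, 2 or 4 in absolute value. So \<open>F\<close> is at least 6, which means weight at most 4.
    The inequality reads 70560 < 86016.\<close>
  obtain v where v: "v \<in> dual_code J E1" "v \<noteq> 0" "2 * weight v \<le> 14"
    "0 < ((int 14 - 2 * int (weight v))\<^sup>2 - 0) * ((int 14 - 2 * int (weight v))\<^sup>2 - 16)"
    using E1(3) even min
    by (elim exists_low_weight_dual_word[OF J E1(2) _ E1(4-6), where \<alpha> = 0 and \<beta> = 16, rotated -1])
      (auto simp: power2_eq_square)
  have "(int 4)\<^sup>2 < (int 14 - 2 * int (weight v))\<^sup>2"
    using v(4) by (auto simp: zero_less_mult_iff)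
  then have "weight v \<le> Suc 3" using square_le_imp_weight_le[OF v(3)] by fastforce
  then obtain J' E2 where E2: "J' \<subseteq> J" "card J' = 10" "E2 \<subseteq> E1" "E2 \<subseteq> words J'"
    "word.subspace E2" "card E2 = 2 ^ 3"
    using shorten_at_dual_word[OF J E1(4,5), of 3 3 v] v(1,2) E1(6,2) by auto
  have "finite J'" using E2(1) J finite_subset by blast
  \<comment> \<open>Length 10, 8 codewords and distance 6 would require 2 * 6 * 7 = 84 to be at most
    80.\<close>
  then show False
    using plotkin[OF _ E2(4,5), of 6] E2(2,3,6) E1(3) min by force
qed

text \<open>Reduction to even codes at the same length: one coordinate is overwritten by the parity
  of the other 20. A weight drops by at most 1 and becomes even, so it stays at least 6, and no
  nonzero codeword is lost.\<close>

lemma no_code_21_12_6: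
  assumes C: "binary_code I 21 12 \<delta> C"
  shows "\<delta> < 6"
proof (rule ccontr)
  assume \<delta>: "\<not> \<delta> < 6"
  have I: "finite I" "card I = 21" and C: "C \<subseteq> words I" "word.subspace C" "word.dim C = 12"
    and min: "\<And>c. c \<in> C \<Longrightarrow> c \<noteq> 0 \<Longrightarrow> 6 \<le> weight c"
    using C \<delta> has_min_dist_subspace[of C \<delta>] by (force simp: binary_code_def)+
  have fin: "finite C" using C I finite_subset finite_words by blast
  have C_add: "\<And>u v. u \<in> C \<Longrightarrow> v \<in> C \<Longrightarrow> u + v \<in> C" "0 \<in> C"
    using C(2) by (auto simp: subspace_word_iff)
  obtain p where p: "p \<in> I" using I(2) by fastforce
  define f where "f c = c(p := \<Sum>i\<in>I - {p}. c i)" for c :: "'a \<Rightarrow> bit"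
  have f_add: "f (u + v) = f u + f v" for u v
    by (auto simp: f_def fun_eq_iff sum.distrib)
  have f_words: "f c \<in> words I" if "c \<in> C" for c
    using that C(1) p by (auto simp: words_def f_def)
  have even: "even (weight (f c))" if "c \<in> C" for c
  proof -
    have "(of_nat (weight (f c)) :: bit) = (\<Sum>i\<in>I. f c i)"
      using sum_word_eq_of_nat_weight[OF I(1) f_words[OF that]] by simp
    also have "\<dots> = f c p + (\<Sum>i\<in>I - {p}. f c i)" by (rule sum.remove[OF I(1) p])
    also have "\<dots> = 0" by (simp add: f_def)
    finally show ?thesis by (metis even_of_nat even_zero)
  qed
  have weight: "6 \<le> weight (f c)" if c: "c \<in> C" "c \<noteq> 0" for c
  proof -
    have "c \<in> words I" "f c \<in> words I" using c C(1) f_words by auto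
    then have fin: "finite {i. f c i \<noteq> 0}"
      by (intro finite_subset[OF _ I(1)]) (auto simp: words_def)
    have "{i. c i \<noteq> 0} \<subseteq> insert p {i. f c i \<noteq> 0}" by (auto simp: f_def)
    then have "weight c \<le> card (insert p {i. f c i \<noteq> 0})"
      unfolding weight_def using fin by (intro card_mono) auto
    also have "\<dots> \<le> Suc (weight (f c))"
      using fin by (simp only: weight_def card_insert_if) simp
    finally have "weight c \<le> Suc (weight (f c))" .
    moreover have "6 \<le> weight c" using min c by blast
    ultimately have "5 \<le> weight (f c)" by simp
    moreover have "weight (f c) \<noteq> 5" using even[OF c(1)] by auto
    ultimately show ?thesis by simp
  qed
  have ker: "{c\<in>C. f c = 0} = {0}"
  proof -
    have "c = 0" if "c \<in> C" "f c = 0" for c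
      using weight[OF that(1)] that(2) by (fastforce simp: weight_def)
    moreover have "f 0 = 0" using f_add[of 0 0] by simp
    ultimately show ?thesis using C_add(2) by blast
  qed
  have "card (f ` C) = 2 ^ 12"
    using card_eq_kernel_image[OF fin C_add(1), of f] f_add ker card_subspace_word[OF fin C(2)] C(3) by simp
  moreover have "word.subspace (f ` C)"
    unfolding subspace_word_iff
  proof (intro conjI ballI)
    show "0 \<in> f ` C" using ker by force
    fix u v assume "u \<in> f ` C" "v \<in> f ` C"
    then show "u + v \<in> f ` C" using C_add(1) by (auto simp: f_add[symmetric])
  qed
  moreover have "f ` C \<subseteq> words I" using f_words by auto
  moreover have "6 \<le> weight c'" if "c' \<in> f ` C" "c' \<noteq> 0" for c'
    using that ker weight by fastforce
  ultimately show False
    using no_even_code_21_12_6[OF I, of "f ` C"] even by blast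
qed

lemma distance_optimal_21_12_5: "distance_optimal 21 12 5"
  unfolding distance_optimal_def using no_code_21_12_6 by fastforce

section \<open>Finite fields of characteristic two\<close>

text \<open>Substituting \<open>w = y + z\<close> in the double sum turns \<open>Q y + Q w\<close>
  into \<open>Q z + B y z\<close>, which is additive in \<open>y\<close> apart from a constant. The
  inner sum then vanishes unless \<open>z\<close> lies in the radical of \<open>B\<close>.\<close>

lemma sum_chi_quadratic_square:
  fixes Q :: "'b::{finite,ab_group_add} \<Rightarrow> bit"
  assumes B: "\<And>x y z. B (x + y) z = B x z + B y z"
    and Q: "\<And>y z. Q (y + z) = Q y + Q z + B y z"
  shows "(\<Sum>y\<in>UNIV. chi (Q y))\<^sup>2 = int CARD('b) * (\<Sum>z | \<forall>y. B y z = 0. chi (Q z))"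
proof -
  have "(\<Sum>y\<in>UNIV. chi (Q y))\<^sup>2 = (\<Sum>y\<in>UNIV. \<Sum>w\<in>UNIV. chi (Q y) * chi (Q w))"
    by (simp add: power2_eq_square sum_product)
  also have "\<dots> = (\<Sum>y\<in>UNIV. \<Sum>z\<in>UNIV. chi (Q y) * chi (Q (y + z)))"
  proof (rule sum.cong[OF refl])
    fix y :: 'b
    have "bij (\<lambda>z. y + z)" by (intro bij_betw_byWitness[where f' = "\<lambda>z. z - y"]) auto
    then show "(\<Sum>w\<in>UNIV. chi (Q y) * chi (Q w)) = (\<Sum>z\<in>UNIV. chi (Q y) * chi (Q (y + z)))"
      by (rule sum.reindex_bij_betw[symmetric])
  qed
  also have "\<dots> = (\<Sum>y\<in>UNIV. \<Sum>z\<in>UNIV. chi (Q z) * chi (B y z))"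
    by (intro sum.cong refl) (simp add: Q chi_add chi_def)
  also have "\<dots> = (\<Sum>z\<in>UNIV. chi (Q z) * (\<Sum>y\<in>UNIV. chi (B y z)))"
    by (subst sum.swap) (simp add: sum_distrib_left)
  also have "\<dots> = (\<Sum>z\<in>UNIV. if \<forall>y. B y z = 0 then int CARD('b) * chi (Q z) else 0)"
    using B by (intro sum.cong refl) (simp add: sum_chi_additive)
  also have "\<dots> = int CARD('b) * (\<Sum>z | \<forall>y. B y z = 0. chi (Q z))"
    by (simp add: sum.If_cases sum_distrib_left)
  finally show ?thesis .
qed

locale binary_field =
  fixes m :: nat and ty :: "'a::finite_field itself"
  assumes card_field: "CARD('a) = 2 ^ m"
begin

lemma m_pos: "m > 0"
proof -
  have "card {0, 1 :: 'a} \<le> CARD('a)" by (rule card_mono) auto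
  then show ?thesis using card_field by (cases m) auto
qed

lemma power_card [simp]: "(x::'a) ^ (2 ^ m) = x"
  using finite_field_power_card_eq_same[of x] card_field by simp

lemma add_self [simp]: "(x::'a) + x = 0"
proof -
  have "(-1 :: 'a) ^ (2 ^ m) = 1" using m_pos by (metis even_power even_numeral neg_one_even_power)
  then have "1 + 1 = (0::'a)" by (metis power_card add.right_inverse)
  then show ?thesis by (metis mult_2 mult_zero_left one_add_one)
qed

lemma two_eq_0: "(2::'a) = 0"
  by (metis one_add_one add_self)

lemma add_eq_0_iff_eq: "(x::'a) + y = 0 \<longleftrightarrow> x = y"
  by (metis add_self add_left_cancel)

lemma add_add_cancel [simp]: "(x::'a) + (x + y) = y"
  by (simp add: add.assoc[symmetric])

lemma uminus_eq [simp]: "- (x::'a) = x"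
  by (metis add_self add.inverse_unique)

lemma frob_add: "((x::'a) + y) ^ (2 ^ i) = x ^ (2 ^ i) + y ^ (2 ^ i)"
proof (induction i)
  case (Suc i)
  have sq: "(a + b)\<^sup>2 = a\<^sup>2 + b\<^sup>2" for a b :: 'a
    by (simp add: power2_sum mult_2)
  show ?case using Suc by (simp add: mult.commute[of 2] power_mult sq)
qed simp

lemma frob_frob: "((x::'a) ^ (2 ^ i)) ^ (2 ^ j) = x ^ (2 ^ (i + j))"
  by (simp add: power_mult power_add)

lemma frob_eq_0_iff [simp]: "(x::'a) ^ (2 ^ i) = 0 \<longleftrightarrow> x = 0"
  by simp

lemma frob_eq_iff: "(x::'a) ^ (2 ^ i) = y ^ (2 ^ i) \<longleftrightarrow> x = y"
  using frob_eq_0_iff[of "x + y" i] by (simp only: frob_add add_eq_0_iff_eq)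

lemma frob_surj: "\<exists>y. (y::'a) ^ (2 ^ i) = x"
proof -
  have "inj (\<lambda>y::'a. y ^ (2 ^ i))" by (simp add: inj_on_def frob_eq_iff)
  then have "surj (\<lambda>y::'a. y ^ (2 ^ i))" by (simp add: finite_UNIV_inj_surj)
  then show ?thesis by (metis surjD)
qed

lemma frob_fixed_mult: "(x::'a) ^ (2 ^ i) = x \<Longrightarrow> x ^ (2 ^ (i * j)) = x"
proof (induction j)
  case (Suc j)
  then show ?case using frob_frob[of x "i * j" i] by (simp add: add.commute)
qed simp

section \<open>The absolute trace\<close>

abbreviation tr :: "'a \<Rightarrow> bit" where "tr \<equiv> abs_trace m"

lemma tr_add: "tr (x + y) = tr x + tr y"
proof -
  have "(of_bit (tr (x + y)) :: 'a) = of_bit (tr x) + of_bit (tr y)"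
    by (simp only: of_bit_abs_trace[OF card_field] frob_add sum.distrib)
  then show ?thesis by (cases "tr x"; cases "tr y"; cases "tr (x + y)") auto
qed

lemma tr_0 [simp]: "tr 0 = 0"
  using tr_add[of 0 0] by simp

lemma tr_sum: "tr (\<Sum>x\<in>A. f x) = (\<Sum>x\<in>A. tr (f x))"
  by (induction A rule: infinite_finite_induct) (simp_all add: tr_add)

lemma tr_frob: "tr (x ^ (2 ^ i)) = tr x"
proof (induction i)
  case (Suc i)
  have sq: "tr (y\<^sup>2) = tr y" for y
  proof -
    have "(\<Sum>i<m. y\<^sup>2 ^ (2 ^ i)) + y = (\<Sum>i<Suc m. y ^ (2 ^ i))"
      by (subst sum.lessThan_Suc_shift) (simp flip: power_mult)
    also have "\<dots> = (\<Sum>i<m. y ^ (2 ^ i)) + y" by simp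
    finally show ?thesis by (simp add: abs_trace_def)
  qed
  have "x ^ (2 ^ Suc i) = (x ^ (2 ^ i))\<^sup>2" by (simp add: mult.commute[of 2] power_mult)
  then show ?case using Suc sq by simp
qed simp

text \<open>The trace is a nonzero polynomial of degree at most \<open>2 ^ (m - 1)\<close>, so it
  cannot vanish at all \<open>2 ^ m\<close> elements.\<close>

lemma tr_surj: "\<exists>x. tr x = 1"
proof (rule ccontr)
  assume "\<not> (\<exists>x. tr x = 1)"
  then have z: "(\<Sum>i<m. x ^ (2 ^ i)) = 0" for x :: 'a
    by (metis abs_trace_def)
  define p :: "'a poly" where "p = (\<Sum>i<m. monom 1 (2 ^ i))"
  have "coeff p (2 ^ (m - 1)) = (\<Sum>i<m. if i = m - 1 then 1 else 0)"
    unfolding p_def coeff_sum coeff_monom by (intro sum.cong) auto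
  also have "\<dots> = 1" using m_pos by simp
  finally have "p \<noteq> 0" by auto
  have "degree p \<le> 2 ^ (m - 1)"
    unfolding p_def by (intro degree_sum_le) (auto simp: degree_monom_eq)
  moreover have "{x. poly p x = 0} = UNIV" by (auto simp: p_def poly_sum poly_monom z)
  ultimately have "2 ^ m \<le> (2::nat) ^ (m - 1)"
    using card_poly_roots_bound[OF \<open>p \<noteq> 0\<close>] card_field by (metis le_trans)
  then have "m \<le> m - 1" by (simp only: power_increasing_iff one_less_numeral_iff semiring_norm)
  then show False using m_pos by simp
qed

lemma tr_nondegenerate:
  assumes "x \<noteq> 0"
  obtains a where "tr (a * x) = 1"
proof -
  obtain y where "tr y = 1" using tr_surj by blast
  then show ?thesis using that[of "y / x"] assms by simp
qed

section \<open>Roots of unity, subfields and semilinear equations\<close>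

lemma power_order [simp]: "(x::'a) \<noteq> 0 \<Longrightarrow> x ^ (2 ^ m - 1) = 1"
proof -
  assume "x \<noteq> 0"
  moreover have "x * x ^ (2 ^ m - 1) = x * 1"
    by (metis mult.right_neutral power_card power_minus_mult mult.commute zero_less_numeral zero_less_power)
  ultimately show ?thesis by simp
qed

lemma power_eq_of_cong:
  assumes "(x::'a) \<noteq> 0" "[a = b] (mod (2 ^ m - 1))"
  shows "x ^ a = x ^ b"
proof -
  have "x ^ c = x ^ (c mod (2 ^ m - 1))" for c
  proof -
    have "x ^ c = x ^ ((2 ^ m - 1) * (c div (2 ^ m - 1)) + c mod (2 ^ m - 1))" by simp
    also have "\<dots> = x ^ (c mod (2 ^ m - 1))"
      unfolding power_add power_mult power_order[OF assms(1)] by simp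
    finally show ?thesis .
  qed
  from this[of a] this[of b] show ?thesis using assms(2) by (simp only: cong_def)
qed

lemma card_power_fibre_le:
  assumes "N > 0"
  shows "card {x::'a. x ^ N = y} \<le> N"
proof -
  let ?p = "monom (1::'a) N + [:- y:]"
  have deg: "degree ?p = N"
    using assms by (subst degree_add_eq_left) (simp_all add: degree_monom_eq)
  then have "?p \<noteq> 0" using assms by auto
  moreover have "{x. poly ?p x = 0} = {x. x ^ N = y}"
    by (auto simp: poly_monom add_eq_0_iff_eq)
  ultimately show ?thesis using card_poly_roots_bound[of ?p] deg by simp
qed

text \<open>The map \<open>x \<mapsto> x ^ M\<close> sends the \<open>N * M\<close> nonzero elements
  to \<open>N\<close>-th roots of unity with fibres of size at most \<open>M\<close>. This forces at
  least \<open>N\<close> roots, and the degree bound allows no more.\<close>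

lemma card_roots_of_unity:
  assumes "N * M = 2 ^ m - 1"
  shows "card {x::'a. x ^ N = 1} = N"
proof -
  have "(2::nat) ^ m > 1" by (rule one_less_power) (use m_pos in auto)
  then have "N * M \<noteq> 0" using assms by simp
  then have pos: "N > 0" "M > 0" by auto
  let ?S = "UNIV - {0::'a}" and ?R = "{x::'a. x ^ N = 1}"
  have "2 ^ m - 1 = card ?S" using card_field by (simp add: card_Diff_singleton)
  also have "\<dots> = (\<Sum>x\<in>?S. 1)" by simp
  also have "\<dots> = (\<Sum>y\<in>?R. of_nat (card {x\<in>?S. x ^ M = y}) * 1)"
  proof (rule sum_fun_comp)
    have "(x ^ M) ^ N = 1" if "x \<noteq> 0" for x :: 'a
      using power_order[OF that] by (simp only: power_mult[symmetric] mult.commute[of M] assms)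
    then show "(\<lambda>x. x ^ M) ` ?S \<subseteq> ?R" by auto
  qed auto
  also have "\<dots> \<le> (\<Sum>y\<in>?R. M)"
  proof (rule sum_mono)
    fix y :: 'a
    have "card {x\<in>?S. x ^ M = y} \<le> card {x. x ^ M = y}" by (rule card_mono) auto
    then show "of_nat (card {x\<in>?S. x ^ M = y}) * 1 \<le> M"
      using card_power_fibre_le[OF pos(2), of y] by simp
  qed
  finally have "N * M \<le> card ?R * M" using assms by simp
  then show ?thesis using card_power_fibre_le[OF pos(1), of 1] pos by simp
qed

lemma card_subfield:
  assumes "m = j * l"
  shows "card {x::'a. x ^ (2 ^ j) = x} = 2 ^ j"
proof -
  have j: "j > 0" using assms m_pos by simp
  have "(2 ^ j - 1 :: int) dvd (2 ^ j) ^ l - 1"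
    unfolding power_diff_1_eq by (rule dvd_triv_left)
  then have "int (2 ^ j - 1) dvd int (2 ^ m - 1)"
    by (simp add: assms power_mult of_nat_diff)
  then obtain M where M: "(2 ^ j - 1) * M = 2 ^ m - (1::nat)"
    using int_dvd_int_iff[THEN iffD1] by (metis dvd_def)
  have "x ^ (2 ^ j) = x \<longleftrightarrow> x = 0 \<or> x ^ (2 ^ j - 1) = 1" for x :: 'a
  proof -
    have "x ^ (2 ^ j) = x * x ^ (2 ^ j - 1)"
      by (metis power_minus_mult mult.commute zero_less_numeral zero_less_power)
    then show ?thesis by auto
  qed
  then have "{x::'a. x ^ (2 ^ j) = x} = insert 0 {x. x ^ (2 ^ j - 1) = 1}" by auto
  moreover have "(0::'a) ^ (2 ^ j - 1) \<noteq> 1"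
    using j one_less_power[of "2::nat" j] by (simp add: power_0_left)
  ultimately show ?thesis
    using card_roots_of_unity[OF M] one_le_power[of "2::nat" j] by simp
qed

text \<open>
  Dividing by a root \<open>y\<close> makes \<open>1\<close> a root, so that \<open>u \<mapsto> \<tau> u + u\<close> lowers the order of the
  equation by one and has the fixed field as its kernel.
\<close>

lemma card_semilinear_kernel:
  fixes c0 c1 c2 :: 'a and s :: nat
  defines "\<tau> \<equiv> \<lambda>x::'a. x ^ (2 ^ s)"
  defines "R \<equiv> {x. c1 * \<tau> x + c2 * \<tau> (\<tau> x) + c0 * x = 0}"
  assumes c2: "c2 \<noteq> 0"
  shows "card R \<in> {1, card {x. \<tau> x = x}, (card {x. \<tau> x = x})\<^sup>2}"
proof (cases "R = {0}")
  case False
  let ?K = "{x. \<tau> x = x}"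
  have \<tau>_add: "\<tau> (x + y) = \<tau> x + \<tau> y" and \<tau>_mult: "\<tau> (x * y) = \<tau> x * \<tau> y"
    and \<tau>_div: "\<tau> (x / y) = \<tau> x / \<tau> y" and \<tau>_0: "\<tau> x = 0 \<longleftrightarrow> x = 0" for x y
    by (simp_all add: \<tau>_def frob_add power_mult_distrib power_divide)
  have R_add: "x + y \<in> R" if "x \<in> R" "y \<in> R" for x y
  proof -
    have "c1 * \<tau> (x + y) + c2 * \<tau> (\<tau> (x + y)) + c0 * (x + y) =
      (c1 * \<tau> x + c2 * \<tau> (\<tau> x) + c0 * x) + (c1 * \<tau> y + c2 * \<tau> (\<tau> y) + c0 * y)"
      by (simp add: \<tau>_add algebra_simps)
    then show ?thesis using that by (simp add: R_def)
  qed
  have R_mult: "c * x \<in> R" if "c \<in> ?K" "x \<in> R" for c x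
  proof -
    have "c1 * \<tau> (c * x) + c2 * \<tau> (\<tau> (c * x)) + c0 * (c * x) =
      c * (c1 * \<tau> x + c2 * \<tau> (\<tau> x) + c0 * x)"
      using that(1) by (simp add: \<tau>_mult algebra_simps)
    then show ?thesis using that(2) by (simp add: R_def)
  qed
  have "0 \<in> R" by (simp add: R_def \<tau>_def power_0_left)
  then obtain y where y: "y \<in> R" "y \<noteq> 0" using False by auto
  define f where "f x = \<tau> (x / y) + x / y" for x
  have f_add: "f (x + z) = f x + f z" for x z
    by (simp add: f_def add_divide_distrib \<tau>_add ac_simps)
  have f_mult: "f (c * x) = c * f x" if "c \<in> ?K" for c x
    using that \<tau>_mult[of c "x / y"] by (simp add: f_def distrib_left)
  have "{x\<in>R. f x = 0} = (\<lambda>c. c * y) ` ?K"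
  proof
    show "(\<lambda>c. c * y) ` ?K \<subseteq> {x\<in>R. f x = 0}"
      using R_mult y by (auto simp: f_def)
    show "{x\<in>R. f x = 0} \<subseteq> (\<lambda>c. c * y) ` ?K"
    proof
      fix x assume "x \<in> {x\<in>R. f x = 0}"
      then have "x / y \<in> ?K" by (simp add: f_def add_eq_0_iff_eq)
      then show "x \<in> (\<lambda>c. c * y) ` ?K" using y(2) by (intro image_eqI[of _ _ "x / y"]) auto
    qed
  qed
  then have ker: "card {x\<in>R. f x = 0} = card ?K"
    using y(2) by (simp add: card_image inj_on_def)
  have cardR: "card R = card ?K * card (f ` R)"
    using card_eq_kernel_image[of R f] R_add f_add ker by simp
  show ?thesis
  proof (cases "f ` R = {0}")
    case True
    then show ?thesis using cardR by simp
  next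
    case False
    have "f 0 = 0" by (simp add: f_def \<tau>_def power_0_left)
    then have "0 \<in> f ` R" using \<open>0 \<in> R\<close> by (metis image_eqI)
    then obtain z where z: "z \<in> R" "f z \<noteq> 0" using False by auto
    define b c where "b = c2 * \<tau> (\<tau> y)" and "c = c0 * y"
    have "b \<noteq> 0" using c2 y(2) by (simp add: b_def \<tau>_0)
    have eq: "b * \<tau> (f x) = c * f x" if "x \<in> R" for x
    proof -
      define u where "u = x / y"
      have x: "x = u * y" using y(2) by (simp add: u_def)
      \<comment> \<open>The equation for \<open>y\<close> itself, used to eliminate
        \<open>c1\<close>.\<close>
      have a: "c1 * \<tau> y = b + c"
        using y(1) by (simp add: R_def b_def c_def add.assoc add_eq_0_iff_eq)
      have "c1 * \<tau> x + c2 * \<tau> (\<tau> x) + c0 * x = (c1 * \<tau> y) * \<tau> u + b * \<tau> (\<tau> u) + c * u"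
        by (simp add: x \<tau>_mult b_def c_def algebra_simps)
      also have "\<dots> = b * \<tau> (\<tau> u + u) + c * (\<tau> u + u)"
        unfolding a by (simp add: \<tau>_add algebra_simps)
      finally show ?thesis
        using that by (simp add: R_def f_def u_def add_eq_0_iff_eq)
    qed
    have "b * \<tau> (f z) \<noteq> 0" unfolding mult_eq_0_iff \<tau>_0 using z(2) \<open>b \<noteq> 0\<close> by blast
    then have "c \<noteq> 0" unfolding eq[OF z(1)] by auto
    have "f ` R = (\<lambda>c. c * f z) ` ?K"
    proof
      show "(\<lambda>c. c * f z) ` ?K \<subseteq> f ` R"
        using R_mult[OF _ z(1)] f_mult[symmetric] by auto
      show "f ` R \<subseteq> (\<lambda>c. c * f z) ` ?K"
      proof (rule image_subsetI)
        fix x assume x: "x \<in> R"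
        \<comment> \<open>Both \<open>f x\<close> and \<open>f z\<close> solve the same first-order
          equation, so their quotient is fixed by \<open>\<tau>\<close>.\<close>
        have t: "\<tau> (f w) = c * f w / b" if "w \<in> R" for w
          using eq[OF that] \<open>b \<noteq> 0\<close> by (simp add: field_simps)
        have "\<tau> (f x / f z) = f x / f z"
          unfolding \<tau>_div t[OF x] t[OF z(1)] using \<open>b \<noteq> 0\<close> \<open>c \<noteq> 0\<close> by simp
        then show "f x \<in> (\<lambda>c. c * f z) ` ?K"
          using z(2) by (intro image_eqI[of _ _ "f x / f z"]) auto
      qed
    qed
    then have "card (f ` R) = card ?K" using z(2) by (simp add: card_image inj_on_def)
    then show ?thesis using cardR by (simp add: power2_eq_square)
  qed
qed simp

end

section \<open>Weights of the trace code\<close>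

text \<open>The hypotheses in derived form: \<open>r \<ge> 3\<close> encodes
  \<open>k \<noteq> m div 2\<close> once \<open>r\<close> is known to be odd, and \<open>D\<close>
  is given as the group of \<open>t\<close>-th powers, independently of the chosen
  generator.\<close>

locale trace_code_setting = binary_field m ty for m and ty :: "'a::finite_field itself" +
  fixes h k r t d n :: nat and D :: "'a set"
  assumes m_eq: "m = 2 * h" and h_eq: "h = k * r" and r: "odd r" "r \<ge> 3" and k: "k > 0"
    and t_eq: "t = 2 ^ k + 1" and t_dvd: "t dvd 2 ^ h + 1" and n_eq: "t * n = 2 ^ m - 1"
    and d: "[d * t = 2 ^ h + 1] (mod (2 ^ m - 1))"
    and D_eq: "D = {x. \<exists>y. y \<noteq> 0 \<and> x = y ^ t}"
begin

lemma t_ge: "t \<ge> 3"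
proof -
  have "(2::nat) ^ 1 \<le> 2 ^ k" using k by (intro power_increasing) auto
  then show ?thesis by (simp add: t_eq)
qed

lemma h_ge: "h \<ge> 3 * k"
  using r(2) by (simp add: h_eq)

lemma m_eq_2k: "m = 2 * k * r"
  by (simp add: m_eq h_eq)

lemma h_eq_2k: "h = 2 * k * (r div 2) + k"
proof -
  have "r = 2 * (r div 2) + 1" using r(1) by presburger
  then have "k * r = k * (2 * (r div 2) + 1)" by simp
  then show ?thesis by (simp add: h_eq algebra_simps)
qed

lemma card_K: "card {x::'a. x ^ (2 ^ (2 * k)) = x} = 2 ^ (2 * k)"
  by (rule card_subfield[OF m_eq_2k])

text \<open>Since \<open>h\<close> is an odd multiple of \<open>k\<close>, the exponents
  \<open>2 ^ h\<close> and \<open>2 ^ k\<close> induce the same conjugation on the field of order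
  \<open>4 ^ k\<close>.\<close>

lemma K_frob_h: "(x::'a) ^ (2 ^ (2 * k)) = x \<Longrightarrow> x ^ (2 ^ h) = x ^ (2 ^ k)"
  using frob_fixed_mult[of x "2 * k" "r div 2"] frob_frob[of x "2 * k * (r div 2)" k]
  by (simp add: h_eq_2k[symmetric])

text \<open>An element of relative trace 1: any \<open>x\<close> moved by the conjugation is divided
  by its trace \<open>x + x ^ (2 ^ k)\<close>, which is nonzero and fixed.\<close>

lemma K_conjugate:
  obtains c :: 'a where "c ^ (2 ^ k) = c + 1" "c ^ (2 ^ h) = c + 1"
proof -
  let ?K = "{x::'a. x ^ (2 ^ (2 * k)) = x}"
  have "card {x::'a. x ^ (2 ^ k) = x} = 2 ^ k"
    by (rule card_subfield[of _ "2 * r"]) (simp add: m_eq h_eq)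
  moreover have "(2::nat) ^ k < 2 ^ (2 * k)" using k by (intro power_strict_increasing) auto
  ultimately have "\<not> ?K \<subseteq> {x::'a. x ^ (2 ^ k) = x}"
    using card_mono[of "{x::'a. x ^ (2 ^ k) = x}" ?K] by (simp only: card_K) auto
  then obtain x :: 'a where x: "x ^ (2 ^ (2 * k)) = x" "x ^ (2 ^ k) \<noteq> x" by blast
  define e where "e = x + x ^ (2 ^ k)"
  have e: "e \<noteq> 0" using x(2) by (simp add: e_def add_eq_0_iff_eq eq_commute[of x])
  have "(x ^ (2 ^ k)) ^ (2 ^ k) = x"
    using x(1) frob_frob[of x k k] by (simp add: mult_2)
  then have ek: "e ^ (2 ^ k) = e" by (simp add: e_def frob_add add.commute)
  define c where "c = x / e"
  have "c + c ^ (2 ^ k) = 1"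
    using e ek by (simp add: c_def power_divide e_def add_divide_distrib[symmetric])
  then have ck: "c ^ (2 ^ k) = c + 1" by (metis add_add_cancel)
  then have "c ^ (2 ^ (2 * k)) = c"
    using frob_frob[of c k k] by (simp add: mult_2 frob_add add.assoc)
  then show ?thesis using K_frob_h that ck by metis
qed

lemma power_dt: "(y::'a) \<noteq> 0 \<Longrightarrow> (y ^ t) ^ d = y ^ (2 ^ h + 1)"
  using power_eq_of_cong[OF _ d] by (simp add: power_mult[symmetric] mult.commute)

lemma finite_D: "finite D"
  by simp

lemma zero_notin_D: "0 \<notin> D"
  by (simp add: D_eq)

lemma D_divide_closed: "x \<in> D \<Longrightarrow> y \<in> D \<Longrightarrow> x / y \<in> D"
  by (auto simp: D_eq) (metis divide_eq_0_iff power_divide)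

lemma sum_over_D:
  fixes g :: "'a \<Rightarrow> int"
  shows "(\<Sum>y\<in>UNIV - {0}. g (y ^ t)) = int t * (\<Sum>x\<in>D. g x)"
proof -
  have fibre: "card {y \<in> UNIV - {0}. y ^ t = x} = t" if x: "x \<in> D" for x
  proof -
    obtain z where z: "z \<noteq> 0" "x = z ^ t" using x by (auto simp: D_eq)
    have "{y \<in> UNIV - {0}. y ^ t = x} = (\<lambda>u. u * z) ` {u. u ^ t = 1}"
    proof
      show "(\<lambda>u. u * z) ` {u. u ^ t = 1} \<subseteq> {y \<in> UNIV - {0}. y ^ t = x}"
        using z t_ge by (auto simp: power_mult_distrib power_0_left)
      show "{y \<in> UNIV - {0}. y ^ t = x} \<subseteq> (\<lambda>u. u * z) ` {u. u ^ t = 1}"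
      proof
        fix y assume "y \<in> {y \<in> UNIV - {0}. y ^ t = x}"
        then have "(y / z) ^ t = 1" using z by (simp add: power_divide)
        then show "y \<in> (\<lambda>u. u * z) ` {u. u ^ t = 1}"
          using z(1) by (intro image_eqI[of _ _ "y / z"]) auto
      qed
    qed
    then show ?thesis
      using z(1) card_roots_of_unity[OF n_eq] by (simp add: card_image inj_on_def)
  qed
  have "(\<Sum>y\<in>UNIV - {0}. g (y ^ t)) = (\<Sum>x\<in>D. of_nat (card {y \<in> UNIV - {0}. y ^ t = x}) * g x)"
    by (rule sum_fun_comp) (auto simp: D_eq)
  also have "\<dots> = (\<Sum>x\<in>D. int t * g x)"
    using fibre by (intro sum.cong refl) (simp only:)
  finally show ?thesis by (simp add: sum_distrib_left)
qed

lemma card_D: "card D = n"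
proof -
  have "int t * int (card D) = int (card (UNIV - {0::'a}))"
    using sum_over_D[of "\<lambda>_. 1"] by simp
  also have "\<dots> = int (t * n)" using card_field n_eq by (simp add: card_Diff_singleton)
  finally show ?thesis using t_ge by simp
qed

section \<open>Codewords and their exponential sums\<close>

definition codeword :: "'a \<Rightarrow> 'a \<Rightarrow> 'a \<Rightarrow> bit" where
  "codeword a b = (\<lambda>x. if x \<in> D then tr (a * x ^ d + b * x) else 0)"

definition C :: "('a \<Rightarrow> bit) set" where
  "C = trace_code m (\<lambda>x. x ^ d) D"

lemma C_eq: "C = (\<lambda>(a, b). codeword a b) ` UNIV"
  by (auto simp: C_def trace_code_def codeword_def)

lemma codeword_in_C [simp]: "codeword a b \<in> C"
  by (auto simp: C_eq)

lemma codeword_add: "codeword a b + codeword a' b' = codeword (a + a') (b + b')"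
  by (simp add: codeword_def fun_eq_iff tr_add[symmetric] algebra_simps)

lemma C_cases:
  assumes "c \<in> C"
  obtains a b where "c = codeword a b"
  using assms by (auto simp: C_eq)

lemma C_add: "u \<in> C \<Longrightarrow> v \<in> C \<Longrightarrow> u + v \<in> C"
  by (elim C_cases) (simp add: codeword_add)

lemma zero_in_C: "0 \<in> C"
proof -
  have "codeword 0 0 = 0" by (simp add: codeword_def fun_eq_iff)
  then show ?thesis by (metis codeword_in_C)
qed

lemma subspace_C: "word.subspace C"
  using C_add zero_in_C by (simp add: subspace_word_iff)

lemma C_words: "C \<subseteq> words D"
  by (auto simp: C_eq codeword_def words_def)

lemma finite_C: "finite C"
  by (simp add: C_eq)

text \<open>
  \<open>exp_sum\<close> is the exponential sum over the whole field: substituting \<open>x = y ^ t\<close>, which is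
  \<open>t\<close>-to-one, turns \<open>x ^ d\<close> into \<open>y ^ (2 ^ h + 1)\<close>, and \<open>y = 0\<close> contributes \<open>1\<close>.
\<close>

definition exp_sum :: "('a \<Rightarrow> bit) \<Rightarrow> int" where
  "exp_sum c = 1 + int t * (\<Sum>x\<in>D. chi (c x))"

definition quad :: "'a \<Rightarrow> 'a \<Rightarrow> 'a \<Rightarrow> bit" where
  "quad a b y = tr (a * y ^ (2 ^ h + 1) + b * y ^ (2 ^ k + 1))"

lemma exp_sum_codeword: "exp_sum (codeword a b) = (\<Sum>y\<in>UNIV. chi (quad a b y))"
proof -
  have "(\<Sum>y\<in>UNIV. chi (quad a b y)) = chi (quad a b 0) + (\<Sum>y\<in>UNIV - {0}. chi (quad a b y))"
    by (rule sum.remove) auto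
  also have "(\<Sum>y\<in>UNIV - {0}. chi (quad a b y)) = (\<Sum>y\<in>UNIV - {0}. chi (codeword a b (y ^ t)))"
  proof (rule sum.cong[OF refl])
    fix y :: 'a assume "y \<in> UNIV - {0}"
    then have "y ^ t \<in> D" "(y ^ t) ^ d = y ^ (2 ^ h + 1)" using power_dt by (auto simp: D_eq)
    then show "chi (quad a b y) = chi (codeword a b (y ^ t))"
      by (simp add: quad_def codeword_def t_eq)
  qed
  also have "\<dots> = int t * (\<Sum>x\<in>D. chi (codeword a b x))" by (rule sum_over_D)
  finally show ?thesis by (simp add: exp_sum_def quad_def)
qed

text \<open>Its kernel is the radical of \<open>quad\<close>: the polar form is the trace of
  \<open>y ^ (2 ^ k)\<close> times this value. The middle term is written as the square of
  \<open>x \<mapsto> x ^ (2 ^ (h + k))\<close>, although it equals \<open>z ^ (2 ^ (2 * k))\<close>,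
  to display a second-order equation in that single automorphism.\<close>

definition radical_map :: "'a \<Rightarrow> 'a \<Rightarrow> 'a \<Rightarrow> 'a" where
  "radical_map a b z = (a + a ^ (2 ^ h)) ^ (2 ^ k) * z ^ (2 ^ (h + k)) +
    b ^ (2 ^ k) * (z ^ (2 ^ (h + k))) ^ (2 ^ (h + k)) + b * z"

lemma frob_h_h: "((x::'a) ^ (2 ^ h)) ^ (2 ^ h) = x"
  using frob_frob[of x h h] power_card[of x] by (simp add: m_eq mult_2)

lemma frob_twice_hk: "((z::'a) ^ (2 ^ (h + k))) ^ (2 ^ (h + k)) = z ^ (2 ^ (2 * k))"
proof -
  have "(z ^ (2 ^ (h + k))) ^ (2 ^ (h + k)) = (z ^ (2 ^ m)) ^ (2 ^ (2 * k))"
  proof -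
    have "h + k + (h + k) = m + 2 * k" by (simp add: m_eq)
    then show ?thesis by (simp only: frob_frob)
  qed
  then show ?thesis by simp
qed

lemma quad_add: "quad a b (y + z) = quad a b y + quad a b z + tr (y ^ (2 ^ k) * radical_map a b z)"
proof -
  have exp: "(y + z) ^ (2 ^ j + 1) = y ^ (2 ^ j + 1) + z ^ (2 ^ j + 1) + (y ^ (2 ^ j) * z + z ^ (2 ^ j) * y)" for j
    by (simp add: frob_add algebra_simps)
  \<comment> \<open>Frobenius invariance of the trace moves the powers off \<open>y\<close>; a last
    application of \<open>2 ^ k\<close> brings both parts to the common factor
    \<open>y ^ (2 ^ k)\<close>.\<close>
  have "tr (a * (y ^ (2 ^ h) * z)) = tr ((a * (y ^ (2 ^ h) * z)) ^ (2 ^ h))" by (simp only: tr_frob)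
  also have "\<dots> = tr (a ^ (2 ^ h) * z ^ (2 ^ h) * y)"
    by (simp only: power_mult_distrib frob_h_h ac_simps)
  finally have "tr (a * (y ^ (2 ^ h) * z + z ^ (2 ^ h) * y)) = tr ((a + a ^ (2 ^ h)) * z ^ (2 ^ h) * y)"
    by (simp add: tr_add distrib_left distrib_right ac_simps)
  also have "\<dots> = tr (((a + a ^ (2 ^ h)) * z ^ (2 ^ h) * y) ^ (2 ^ k))" by (simp only: tr_frob)
  also have "\<dots> = tr (y ^ (2 ^ k) * ((a + a ^ (2 ^ h)) ^ (2 ^ k) * z ^ (2 ^ (h + k))))"
    by (simp only: power_mult_distrib frob_frob ac_simps)
  finally have A: "tr (a * (y ^ (2 ^ h) * z + z ^ (2 ^ h) * y)) = \<dots>" .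
  have "tr (b * (z ^ (2 ^ k) * y)) = tr ((b * (z ^ (2 ^ k) * y)) ^ (2 ^ k))" by (simp only: tr_frob)
  also have "\<dots> = tr (y ^ (2 ^ k) * (b ^ (2 ^ k) * z ^ (2 ^ (2 * k))))"
    by (simp only: power_mult_distrib frob_frob mult_2 mult_2_right ac_simps)
  finally have B: "tr (b * (y ^ (2 ^ k) * z + z ^ (2 ^ k) * y)) =
      tr (y ^ (2 ^ k) * (b ^ (2 ^ k) * z ^ (2 ^ (2 * k)) + b * z))"
    by (simp add: tr_add distrib_left mult_2 mult_2_right ac_simps)
  have "quad a b (y + z) = quad a b y + quad a b z +
      (tr (a * (y ^ (2 ^ h) * z + z ^ (2 ^ h) * y)) + tr (b * (y ^ (2 ^ k) * z + z ^ (2 ^ k) * y)))"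
    unfolding quad_def exp by (simp only: tr_add[symmetric] distrib_left ac_simps)
  also have "tr (a * (y ^ (2 ^ h) * z + z ^ (2 ^ h) * y)) + tr (b * (y ^ (2 ^ k) * z + z ^ (2 ^ k) * y)) =
      tr (y ^ (2 ^ k) * radical_map a b z)"
    unfolding A B radical_map_def frob_twice_hk tr_add[symmetric] by (simp only: distrib_left ac_simps)
  finally show ?thesis .
qed

lemma radical_iff: "(\<forall>y. tr (y ^ (2 ^ k) * z) = 0) \<longleftrightarrow> z = 0"
proof
  assume a: "\<forall>y. tr (y ^ (2 ^ k) * z) = 0"
  show "z = 0"
  proof (rule ccontr)
    assume "z \<noteq> 0"
    then obtain x where "tr (x * z) = 1" using tr_nondegenerate by blast
    then show False using a frob_surj[of k x] by fastforce
  qed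
qed simp

text \<open>
  With \<open>c\<close> and its conjugate \<open>c + 1\<close> of equal norm, \<open>quad\<close> takes the same value at \<open>c * z\<close> and
  \<open>z + c * z\<close>, so for \<open>z\<close> in the radical it vanishes at \<open>z\<close>.
\<close>

lemma quad_radical:
  assumes "radical_map a b z = 0"
  shows "quad a b z = 0"
proof -
  obtain c :: 'a where c: "c ^ (2 ^ k) = c + 1" "c ^ (2 ^ h) = c + 1" using K_conjugate by blast
  have norm: "(c + 1) ^ (2 ^ j + 1) = c ^ (2 ^ j + 1)" if "c ^ (2 ^ j) = c + 1" for j
    using that by (simp add: frob_add add.assoc)
  have "c * z + z = (c + 1) * z" by (simp add: distrib_right)
  then have "quad a b (c * z + z) = quad a b (c * z)"
    unfolding quad_def by (simp only: power_mult_distrib norm[OF c(1)] norm[OF c(2)])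
  then show ?thesis using quad_add[of a b "c * z" z] assms by simp
qed

lemma card_radical:
  assumes "a + a ^ (2 ^ h) \<noteq> 0 \<or> b \<noteq> 0"
  shows "card {z. radical_map a b z = 0} \<in> {1, 2 ^ (2 * k), (2 ^ (2 * k))\<^sup>2}"
proof (cases "b = 0")
  case True
  then have "{z. radical_map a b z = 0} = {0}"
    using assms by (auto simp: radical_map_def power_0_left)
  then show ?thesis by simp
next
  case False
  \<comment> \<open>One inclusion applies the automorphism twice, as
    \<open>2 * (h + k) = m + 2 * k\<close>; the other holds because \<open>2 ^ h\<close> acts as
    \<open>2 ^ k\<close> on the field of order \<open>4 ^ k\<close>.\<close>
  have "{x::'a. x ^ (2 ^ (h + k)) = x} = {x. x ^ (2 ^ (2 * k)) = x}"
  proof (intro Collect_cong iffI)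
    fix x :: 'a assume "x ^ (2 ^ (h + k)) = x"
    then show "x ^ (2 ^ (2 * k)) = x" using frob_twice_hk[of x] by simp
  next
    fix x :: 'a assume x: "x ^ (2 ^ (2 * k)) = x"
    then show "x ^ (2 ^ (h + k)) = x"
      using K_frob_h[OF x] frob_frob[of x h k] frob_frob[of x k k] by (simp add: mult_2)
  qed
  then show ?thesis
    using card_semilinear_kernel[of "b ^ (2 ^ k)" "(a + a ^ (2 ^ h)) ^ (2 ^ k)" "h + k" b] False card_K
    by (simp add: radical_map_def)
qed

lemma exp_sum_square:
  assumes "a + a ^ (2 ^ h) \<noteq> 0 \<or> b \<noteq> 0"
  shows "(exp_sum (codeword a b))\<^sup>2 \<in> {(2 ^ h)\<^sup>2, (2 ^ (h + k))\<^sup>2, (2 ^ (h + 2 * k))\<^sup>2}"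
proof -
  have "(exp_sum (codeword a b))\<^sup>2 =
      2 ^ m * (\<Sum>z | \<forall>y. tr (y ^ (2 ^ k) * radical_map a b z) = 0. chi (quad a b z))"
    unfolding exp_sum_codeword
    using sum_chi_quadratic_square[of "\<lambda>y z. tr (y ^ (2 ^ k) * radical_map a b z)" "quad a b"]
    by (simp add: quad_add frob_add distrib_right tr_add card_field)
  also have "\<dots> = 2 ^ m * int (card {z. radical_map a b z = 0})"
    by (simp add: radical_iff quad_radical)
  finally show ?thesis
    using card_radical[OF assms]
    by (auto simp: m_eq power_mult[symmetric] power_add[symmetric] algebra_simps)
qed

text \<open>Modulo \<open>t\<close> both \<open>2 ^ k\<close> and \<open>2 ^ h\<close> are -1, so
  each listed value is 1, as is the sum itself. The opposite sign would make \<open>t\<close> divide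
  2.\<close>

lemma exp_sum_values:
  assumes "a + a ^ (2 ^ h) \<noteq> 0 \<or> b \<noteq> 0"
  shows "exp_sum (codeword a b) \<in> {- (2 ^ h), 2 ^ (h + k), - (2 ^ (h + 2 * k))}"
proof -
  let ?S = "exp_sum (codeword a b)" and ?t = "int t"
  have t1: "?t dvd ?S - 1" by (simp add: exp_sum_def)
  have "?t dvd int (2 ^ h + 1)" using t_dvd by (simp only: int_dvd_int_iff)
  then have e0: "?t dvd 2 ^ h + 1" by (simp add: add.commute)
  have "(2::int) ^ (h + k) - 1 = 2 ^ k * (2 ^ h + 1) - ?t" by (simp add: t_eq power_add algebra_simps)
  then have e1: "?t dvd 2 ^ (h + k) - 1" using e0 by (simp only: dvd_diff dvd_mult dvd_refl)
  have "(2::int) ^ (h + 2 * k) + 1 = 2 ^ k * (2 ^ (h + k) - 1) + ?t"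
    by (simp add: t_eq power_add mult_2 mult_2_right algebra_simps)
  then have e2: "?t dvd 2 ^ (h + 2 * k) + 1" using e1 by (simp only: dvd_add dvd_mult dvd_refl)
  have no: False if "?t dvd x" "?t dvd y" "x - y = 2" for x y
    using dvd_diff[OF that(1,2)] that(3) t_ge by (auto dest: zdvd_imp_le)
  have "?S \<noteq> 2 ^ h" using no[OF e0, of "?S - 1"] t1 by auto
  moreover have "?t dvd 1 - ?S" using t1 by (simp only: dvd_diff_commute)
  then have "?S \<noteq> - (2 ^ (h + k))" using no[OF _ e1, of "1 - ?S"] by auto
  moreover have "?S \<noteq> 2 ^ (h + 2 * k)" using no[OF e2, of "?S - 1"] t1 by auto
  ultimately show ?thesis using exp_sum_square[OF assms] by (auto simp: power2_eq_iff)
qed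

text \<open>The kernel of the parametrization is the subfield of order \<open>2 ^ h\<close> in the
  first argument, which lowers the dimension from \<open>4 * h\<close> to \<open>3 * h\<close>. The
  zero word has sum \<open>2 ^ m\<close>, too large for the other values; conversely, the trace
  vanishes on the subfield, because \<open>c * e\<close> and \<open>(c + 1) * e\<close> are
  conjugate.\<close>

lemma codeword_eq_0_iff: "codeword a b = 0 \<longleftrightarrow> a + a ^ (2 ^ h) = 0 \<and> b = 0"
proof
  assume 0: "codeword a b = 0"
  have "exp_sum (codeword a b) = 1 + int (t * n)"
    unfolding 0 by (simp add: exp_sum_def card_D)
  also have "\<dots> = 2 ^ m" by (simp add: n_eq of_nat_diff)
  finally have S: "exp_sum (codeword a b) = 2 ^ m" .
  have "(2::int) ^ (h + k) < 2 ^ m" using h_ge k m_eq by (intro power_strict_increasing) auto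
  then have "exp_sum (codeword a b) \<notin> {- (2 ^ h), 2 ^ (h + k), - (2 ^ (h + 2 * k))}"
    unfolding S by (auto simp: eq_neg_iff_add_eq_0 add_nonneg_eq_0_iff)
  then show "a + a ^ (2 ^ h) = 0 \<and> b = 0" using exp_sum_values[of a b] by blast
next
  assume ab: "a + a ^ (2 ^ h) = 0 \<and> b = 0"
  then have a: "a ^ (2 ^ h) = a" by (simp add: add_eq_0_iff_eq)
  obtain c :: 'a where c: "c ^ (2 ^ h) = c + 1" using K_conjugate by blast
  show "codeword a b = 0"
  proof
    fix x
    show "codeword a b x = 0 x"
    proof (cases "x \<in> D")
      case True
      then obtain y where y: "y \<noteq> 0" "x = y ^ t" by (auto simp: D_eq)
      define e where "e = a * x ^ d"
      have "e ^ (2 ^ h) = e"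
        unfolding e_def y(2) power_dt[OF y(1)] by (simp add: power_mult_distrib a frob_h_h mult.commute)
      then have "tr (c * e) = tr ((c + 1) * e)"
        using tr_frob[of "c * e" h] by (simp add: power_mult_distrib c)
      then have "tr e = 0" by (simp add: distrib_right tr_add)
      then show ?thesis using True ab by (simp add: codeword_def e_def)
    qed (simp add: codeword_def)
  qed
qed

lemma card_C: "card C = 2 ^ (3 * h)"
proof -
  let ?f = "\<lambda>(a, b). codeword a b"
  have "card (UNIV :: ('a \<times> 'a) set) = card {p \<in> UNIV. ?f p = 0} * card (?f ` UNIV)"
    by (rule card_eq_kernel_image) (auto simp: codeword_add)
  moreover have "{p \<in> UNIV. ?f p = 0} = {a. a ^ (2 ^ h) = a} \<times> {0}"
    by (auto simp: codeword_eq_0_iff add_eq_0_iff_eq)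
  moreover have "card {a::'a. a ^ (2 ^ h) = a} = 2 ^ h"
    by (rule card_subfield[of _ 2]) (simp add: m_eq)
  ultimately have "2 ^ m * 2 ^ m = 2 ^ h * card C"
    by (simp add: C_eq card_cartesian_product card_field UNIV_Times_UNIV[symmetric] del: UNIV_Times_UNIV)
  moreover have "(2::nat) ^ m * 2 ^ m = 2 ^ h * 2 ^ (3 * h)"
    by (simp add: m_eq flip: power_add)
  ultimately show ?thesis by simp
qed

lemma dim_C: "word.dim C = 3 * h"
  using card_subspace_word[OF finite_C subspace_C] card_C by simp

lemma two_t_weight:
  assumes "c \<in> C"
  shows "2 * int t * int (weight c) = 2 ^ m - exp_sum c"
proof -
  have F: "(\<Sum>x\<in>D. chi (c x)) = int n - 2 * int (weight c)"
    using sum_chi_word[OF finite_D] C_words assms card_D by auto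
  have "exp_sum c = 1 + int (t * n) - 2 * int t * int (weight c)"
    unfolding exp_sum_def F by (simp add: algebra_simps)
  then show ?thesis by (simp add: n_eq of_nat_diff)
qed

lemma exp_sum_nonzero_codeword:
  assumes "c \<in> C" "c \<noteq> 0"
  shows "exp_sum c \<in> {- (2 ^ h), 2 ^ (h + k), - (2 ^ (h + 2 * k))}"
  using assms exp_sum_values codeword_eq_0_iff by (auto simp: C_eq)

lemma exp_sum_0: "exp_sum 0 = 2 ^ m"
  using two_t_weight[OF zero_in_C] by (simp add: weight_def)

lemma exists_codeword_nonzero: "x \<in> D \<Longrightarrow> \<exists>c\<in>C. c x \<noteq> 0"
proof -
  assume x: "x \<in> D"
  then have "x \<noteq> 0" using zero_notin_D by auto
  then obtain b where "tr (b * x) = 1" using tr_nondegenerate by blast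
  then have "codeword 0 b x \<noteq> 0" using x by (simp add: codeword_def)
  then show ?thesis using codeword_in_C by blast
qed

lemma exists_codeword_separating:
  assumes "x \<in> D" "y \<in> D" "x \<noteq> y"
  shows "\<exists>c\<in>C. c x \<noteq> c y"
proof -
  have "x + y \<noteq> 0" using assms by (simp add: add_eq_0_iff_eq)
  then obtain b where "tr (b * (x + y)) = 1" using tr_nondegenerate by blast
  then have "codeword 0 b x + codeword 0 b y = 1"
    using assms by (simp add: codeword_def tr_add[symmetric] distrib_left)
  then have "codeword 0 b x \<noteq> codeword 0 b y" by auto
  then show ?thesis using codeword_in_C by blast
qed

lemma sum_exp_sum: "(\<Sum>c\<in>C. exp_sum c) = int (card C)"
  using first_moment[OF finite_D finite_C C_add exists_codeword_nonzero]
  by (simp add: exp_sum_def sum.distrib flip: sum_distrib_left)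

lemma sum_exp_sum_square: "(\<Sum>c\<in>C. (exp_sum c)\<^sup>2) = int (card C) * (1 + (int t)\<^sup>2 * int n)"
proof -
  have "(exp_sum c)\<^sup>2 = 1 + 2 * int t * (\<Sum>x\<in>D. chi (c x)) + (int t)\<^sup>2 * (\<Sum>x\<in>D. chi (c x))\<^sup>2" for c
    by (simp add: exp_sum_def power2_eq_square algebra_simps)
  then have "(\<Sum>c\<in>C. (exp_sum c)\<^sup>2) = int (card C) + 2 * int t * (\<Sum>c\<in>C. \<Sum>x\<in>D. chi (c x)) +
      (int t)\<^sup>2 * (\<Sum>c\<in>C. (\<Sum>x\<in>D. chi (c x))\<^sup>2)"
    by (simp add: sum.distrib sum_distrib_left)
  then show ?thesis
    using first_moment[OF finite_D finite_C C_add exists_codeword_nonzero]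
      second_moment[OF finite_D finite_C C_add exists_codeword_separating]
    by (simp add: card_D algebra_simps)
qed

section \<open>Multiplicities of the weights\<close>

definition freq :: "int \<Rightarrow> int" where
  "freq s = int (card {c\<in>C. exp_sum c = s})"

lemma exp_sum_eq_max_iff: "c \<in> C \<Longrightarrow> exp_sum c = 2 ^ m \<longleftrightarrow> c = 0"
  using two_t_weight[of c] weight_eq_0_iff[OF finite_D, of c] C_words t_ge exp_sum_0 by auto

lemma freq_max: "freq (2 ^ m) = 1"
proof -
  have "{c\<in>C. exp_sum c = 2 ^ m} = {0}"
    using exp_sum_eq_max_iff zero_in_C by auto
  then show ?thesis by (simp add: freq_def)
qed

lemma sum_exp_sum_fun:
  fixes g :: "int \<Rightarrow> int"
  shows "(\<Sum>c\<in>C. g (exp_sum c)) = g (2 ^ m) + freq (- (2 ^ h)) * g (- (2 ^ h)) +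
    freq (2 ^ (h + k)) * g (2 ^ (h + k)) + freq (- (2 ^ (h + 2 * k))) * g (- (2 ^ (h + 2 * k)))"
proof -
  have "(2::int) ^ (h + k) < 2 ^ m" using h_ge k m_eq by (intro power_strict_increasing) auto
  moreover have "(2::int) ^ h < 2 ^ (h + 2 * k)" using k by (intro power_strict_increasing) auto
  moreover have "(0::int) < 2 ^ h" "(0::int) < 2 ^ (h + k)" by simp_all
  ultimately have dist: "2 ^ m \<noteq> - ((2::int) ^ h)" "2 ^ m \<noteq> (2::int) ^ (h + k)" "2 ^ m \<noteq> - ((2::int) ^ (h + 2 * k))"
    "- (2 ^ h) \<noteq> (2::int) ^ (h + k)" "- (2 ^ h) \<noteq> - ((2::int) ^ (h + 2 * k))"
    "2 ^ (h + k) \<noteq> - ((2::int) ^ (h + 2 * k))" by linarith+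
  have "(\<Sum>c\<in>C. g (exp_sum c)) =
      (\<Sum>s\<in>{2 ^ m, - (2 ^ h), 2 ^ (h + k), - (2 ^ (h + 2 * k))}. freq s * g s)"
    using sum_fun_comp[OF finite_C, of "{2 ^ m, - (2 ^ h), 2 ^ (h + k), - (2 ^ (h + 2 * k))}" exp_sum g]
      exp_sum_nonzero_codeword exp_sum_0
    by (fastforce simp: freq_def)
  also have "\<dots> = freq (2 ^ m) * g (2 ^ m) + (freq (- (2 ^ h)) * g (- (2 ^ h)) +
    (freq (2 ^ (h + k)) * g (2 ^ (h + k)) + freq (- (2 ^ (h + 2 * k))) * g (- (2 ^ (h + 2 * k)))))"
    using dist by (simp only: sum.insert sum.empty finite.intros insert_iff empty_iff simp_thms add_0_right)
  finally show ?thesis by (simp add: freq_max)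
qed

end

lemma inner_support:
  assumes "finite I" "v \<in> words I"
  shows "inner I u v = (\<Sum>i | v i \<noteq> 0. u i)"
proof -
  have "(\<Sum>i | v i \<noteq> 0. u i) = (\<Sum>i | v i \<noteq> 0. u i * v i)" by (intro sum.cong) auto
  also have "\<dots> = inner I u v"
    using assms by (intro sum.mono_neutral_left) (auto simp: words_def)
  finally show ?thesis by simp
qed

context trace_code_setting
begin

text \<open>Moments of order 0, 1 and 2 of \<open>exp_sum\<close>; the isolated terms 1,
  \<open>X\<^sup>2\<close> and \<open>X ^ 4\<close> come from the zero codeword.\<close>

lemma freq_equations:
  defines "X \<equiv> (2::int) ^ h" and "K \<equiv> (2::int) ^ k"
    and "N1 \<equiv> freq (- (2 ^ h))" and "N2 \<equiv> freq (2 ^ (h + k))" and "N3 \<equiv> freq (- (2 ^ (h + 2 * k)))"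
  shows "1 + N1 + N2 + N3 = X ^ 3"
    and "X\<^sup>2 - X * N1 + X * K * N2 - X * K\<^sup>2 * N3 = X ^ 3"
    and "X ^ 4 + X\<^sup>2 * N1 + X\<^sup>2 * K\<^sup>2 * N2 + X\<^sup>2 * K ^ 4 * N3 = X ^ 3 * (1 + (K + 1) * (X\<^sup>2 - 1))"
proof -
  have pw: "2 ^ m = X\<^sup>2" "2 ^ (h + k) = X * K" "2 ^ (h + 2 * k) = X * K\<^sup>2"
    by (simp_all add: X_def K_def m_eq power_add power_mult[symmetric] mult.commute)
  have cC: "int (card C) = X ^ 3" by (simp add: card_C X_def power_mult[symmetric] mult.commute)
  have "int (t * n) = int (2 ^ m - 1)" by (simp only: n_eq)
  then have tn: "int t * int n = X\<^sup>2 - 1" by (simp add: of_nat_diff pw(1))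
  have tK: "int t = K + 1" by (simp add: t_eq K_def)
  have "int (card C) = 1 + N1 + N2 + N3"
    using sum_exp_sum_fun[of "\<lambda>_. 1"] by (simp add: N1_def N2_def N3_def)
  then show "1 + N1 + N2 + N3 = X ^ 3" using cC by simp
  show "X\<^sup>2 - X * N1 + X * K * N2 - X * K\<^sup>2 * N3 = X ^ 3"
    using sum_exp_sum_fun[of "\<lambda>s. s", folded N1_def N2_def N3_def, unfolded pw, folded X_def]
    by (simp add: sum_exp_sum cC algebra_simps)
  have "(int t)\<^sup>2 * int n = (K + 1) * (X\<^sup>2 - 1)"
    using tn tK by (simp add: power2_eq_square)
  then show "X ^ 4 + X\<^sup>2 * N1 + X\<^sup>2 * K\<^sup>2 * N2 + X\<^sup>2 * K ^ 4 * N3 = X ^ 3 * (1 + (K + 1) * (X\<^sup>2 - 1))"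
    using sum_exp_sum_fun[of "\<lambda>s. s\<^sup>2", folded N1_def N2_def N3_def, unfolded pw, folded X_def]
    by (simp add: sum_exp_sum_square cC power_mult_distrib power_mult[symmetric] mult.commute)
qed

text \<open>The solution of the linear system with denominators cleared, so that it stays in the
  integers. The powers of \<open>X\<close> in the equations are absorbed by a factor
  \<open>X\<^sup>2\<close>, cancelled at the end.\<close>

lemma freq_values:
  defines "X \<equiv> (2::int) ^ h" and "K \<equiv> (2::int) ^ k"
  shows "freq (- (2 ^ h)) * ((K - 1) * (K + 1)\<^sup>2) =
      (X - 1) * (K ^ 3 * X\<^sup>2 - K * X\<^sup>2 - X\<^sup>2 + K ^ 3 * X - K\<^sup>2 * X + K ^ 3)"
    and "freq (2 ^ (h + k)) * (K * (K + 1)\<^sup>2) = (X\<^sup>2 - 1) * (X * (1 + K + K\<^sup>2) + K\<^sup>2)"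
    and "freq (- (2 ^ (h + 2 * k))) * (K * (K - 1) * (K + 1)\<^sup>2) = (X\<^sup>2 - 1) * (X - K)"
proof -
  define N1 N2 N3 where "N1 = freq (- (2 ^ h))" and "N2 = freq (2 ^ (h + k))"
    and "N3 = freq (- (2 ^ (h + 2 * k)))"
  note e = freq_equations[folded X_def K_def N1_def N2_def N3_def]
  have X: "X\<^sup>2 \<noteq> 0" by (simp add: X_def)
  have "X\<^sup>2 * (N1 * ((K - 1) * (K + 1)\<^sup>2)) =
      X\<^sup>2 * ((X - 1) * (K ^ 3 * X\<^sup>2 - K * X\<^sup>2 - X\<^sup>2 + K ^ 3 * X - K\<^sup>2 * X + K ^ 3))"
    using e by algebra
  then show "freq (- (2 ^ h)) * ((K - 1) * (K + 1)\<^sup>2) =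
      (X - 1) * (K ^ 3 * X\<^sup>2 - K * X\<^sup>2 - X\<^sup>2 + K ^ 3 * X - K\<^sup>2 * X + K ^ 3)"
    using X by (simp only: mult_cancel_left N1_def simp_thms)
  have "X\<^sup>2 * (N2 * (K * (K + 1)\<^sup>2)) = X\<^sup>2 * ((X\<^sup>2 - 1) * (X * (1 + K + K\<^sup>2) + K\<^sup>2))"
    using e by algebra
  then show "freq (2 ^ (h + k)) * (K * (K + 1)\<^sup>2) = (X\<^sup>2 - 1) * (X * (1 + K + K\<^sup>2) + K\<^sup>2)"
    using X by (simp only: mult_cancel_left N2_def simp_thms)
  have "X\<^sup>2 * (N3 * (K * (K - 1) * (K + 1)\<^sup>2)) = X\<^sup>2 * ((X\<^sup>2 - 1) * (X - K))"
    using e by algebra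
  then show "freq (- (2 ^ (h + 2 * k))) * (K * (K - 1) * (K + 1)\<^sup>2) = (X\<^sup>2 - 1) * (X - K)"
    using X by (simp only: mult_cancel_left N3_def simp_thms)
qed

lemma weight_eq_iff:
  assumes "c \<in> C"
  shows "real (weight c) = (2 ^ m - of_int s) / (2 * real t) \<longleftrightarrow> exp_sum c = s"
proof -
  have "(of_int (2 * int t * int (weight c)) :: real) = of_int (2 ^ m - exp_sum c)"
    by (simp only: two_t_weight[OF assms])
  then have "real (weight c) = (2 ^ m - of_int (exp_sum c)) / (2 * real t)"
    using t_ge by (simp add: field_simps)
  then show ?thesis using t_ge by (simp add: divide_cancel_right)
qed

lemma weight_multiplicity_eq_freq:
  "real (weight_multiplicity C ((2 ^ m - of_int s) / (2 * real t))) = of_int (freq s)"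
proof -
  have "{c \<in> C. real (weight c) = (2 ^ m - of_int s) / (2 * real t)} = {c \<in> C. exp_sum c = s}"
    using weight_eq_iff by blast
  then show ?thesis by (simp add: weight_multiplicity_def freq_def)
qed

section \<open>Low-weight words of the dual code\<close>

lemma inner_codeword:
  assumes "v \<in> words D"
  shows "inner D (codeword a b) v = tr (a * (\<Sum>x | v x \<noteq> 0. x ^ d) + b * (\<Sum>x | v x \<noteq> 0. x))"
proof -
  have "(\<Sum>x | v x \<noteq> 0. codeword a b x) = (\<Sum>x | v x \<noteq> 0. tr (a * x ^ d + b * x))"
    using assms by (intro sum.cong) (auto simp: codeword_def words_def)
  then show ?thesis
    using inner_support[OF finite_D assms] by (simp add: tr_sum[symmetric] sum.distrib sum_distrib_left)
qed

lemma dual_code_iff: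
  "v \<in> dual_code D C \<longleftrightarrow>
    v \<in> words D \<and> (\<Sum>x | v x \<noteq> 0. x) = 0 \<and> (\<Sum>x | v x \<noteq> 0. x ^ d) = 0"
proof (cases "v \<in> words D")
  case True
  let ?s = "\<Sum>x | v x \<noteq> 0. x" and ?sd = "\<Sum>x | v x \<noteq> 0. x ^ d"
  have "v \<in> dual_code D C \<longleftrightarrow> (\<forall>a b. tr (a * ?sd + b * ?s) = 0)"
    using True inner_codeword[OF True] by (auto simp: dual_code_def C_eq)
  also have "\<dots> \<longleftrightarrow> ?s = 0 \<and> ?sd = 0"
  proof
    assume a: "\<forall>a b. tr (a * ?sd + b * ?s) = 0"
    have "tr (b * ?s) = 0" for b using a[rule_format, of 0 b] by simp
    moreover have "tr (b * ?sd) = 0" for b using a[rule_format, of b 0] by simp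
    ultimately show "?s = 0 \<and> ?sd = 0" by (metis tr_nondegenerate zero_neq_one)
  qed simp
  finally show ?thesis using True by simp
qed (simp add: dual_code_def)

lemma dual_support:
  assumes "v \<in> dual_code D C"
  shows "{x. v x \<noteq> 0} \<subseteq> D" "card {x. v x \<noteq> 0} = weight v"
  using assms by (auto simp: dual_code_def words_def weight_def)

lemma dual_weight_ge_3:
  assumes v: "v \<in> dual_code D C" "v \<noteq> 0"
  shows "3 \<le> weight v"
proof -
  note sums = v(1)[unfolded dual_code_iff]
  have "weight v \<noteq> 0" using weight_eq_0_iff[OF finite_D, of v] v sums by blast
  moreover have "weight v \<noteq> 1"
  proof
    assume "weight v = 1"
    then obtain x where x: "{x. v x \<noteq> 0} = {x}"
      using dual_support(2)[OF v(1)] by (metis card_1_singletonE)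
    then have "x = 0" using sums unfolding x by simp
    then show False using x dual_support(1)[OF v(1)] zero_notin_D by blast
  qed
  moreover have "weight v \<noteq> 2"
  proof
    assume "weight v = 2"
    then obtain x y where x: "{x. v x \<noteq> 0} = {x, y}" "x \<noteq> y"
      using dual_support(2)[OF v(1)] by (metis card_2_iff)
    then have "x + y = 0" using sums unfolding x(1) by simp
    then show False using x(2) by (simp add: add_eq_0_iff_eq)
  qed
  ultimately show ?thesis by linarith
qed

text \<open>
  With \<open>p = u ^ 3\<close> the two conditions determine the trace \<open>N + N\<^sup>2\<close> and the norm \<open>N ^ 3\<close> of \<open>p\<close> over
  the subfield of order \<open>2 ^ h\<close>, where \<open>N\<close> is the norm of \<open>u\<close>. Hence \<open>p\<close> is \<open>N\<close> or \<open>N\<^sup>2\<close>, and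
  either case forces \<open>u ^ 3 = 1\<close>.
\<close>

lemma no_three_term_relation:
  assumes k1: "k = 1" and pq: "p \<in> D" "q \<in> D" "p + q = 1" "p ^ d + q ^ d = 1"
  shows False
proof -
  have t3: "t = 3" by (simp add: t_eq k1)
  obtain u v where u: "u \<noteq> 0" "p = u ^ 3" and v: "v \<noteq> 0" "q = v ^ 3"
    using pq(1,2) by (auto simp: D_eq t3)
  define ub vb N where "ub = u ^ (2 ^ h)" and "vb = v ^ (2 ^ h)" and "N = ub * u"
  have pd: "p ^ d = N" and qd: "q ^ d = vb * v"
    using power_dt[OF u(1)] power_dt[OF v(1)] by (simp_all add: u(2) v(2) t3 N_def ub_def vb_def mult.commute)
  have q: "q = 1 + p" using pq(3) by (metis add.commute add_add_cancel)
  have qN: "vb * v = 1 + N" using pq(4) unfolding pd qd by (metis add.commute add_add_cancel)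
  have "q ^ (2 ^ h) = 1 + p ^ (2 ^ h)" unfolding q by (simp add: frob_add)
  then have qb: "vb ^ 3 = 1 + ub ^ 3"
    by (simp add: u(2) v(2) ub_def vb_def power_mult[symmetric] mult.commute)
  \<comment> \<open>The norm of \<open>q\<close> to the subfield of order \<open>2 ^ h\<close>,
    computed once from \<open>v\<close> and once from \<open>q = 1 + p\<close>; the comparison
    yields the trace of \<open>p\<close>.\<close>
  have "(1 + N) ^ 3 = vb ^ 3 * v ^ 3" unfolding qN[symmetric] by (simp add: power_mult_distrib)
  also have "\<dots> = (1 + ub ^ 3) * (1 + p)" by (simp only: qb v(2)[symmetric] q)
  also have "\<dots> = 1 + (p + ub ^ 3) + N ^ 3" by (simp add: N_def u(2) algebra_simps)
  finally have "1 + N + N\<^sup>2 + N ^ 3 + ((N + N) + (N\<^sup>2 + N\<^sup>2)) = 1 + (p + ub ^ 3) + N ^ 3"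
    by (simp add: power3_eq_cube power2_eq_square two_eq_0 algebra_simps)
  then have tr_p: "N + N\<^sup>2 = p + ub ^ 3" by (simp only: add_self) (simp add: add.assoc)
  \<comment> \<open>The quadratic satisfied by \<open>p\<close> and its conjugate
    \<open>ub ^ 3\<close>, in factored form.\<close>
  have "(p + N) * (p + N\<^sup>2) = p * p + p * (N + N\<^sup>2) + N ^ 3"
    by (simp add: power3_eq_cube power2_eq_square algebra_simps)
  also have "\<dots> = 0" unfolding tr_p by (simp add: N_def u(2) power_mult_distrib algebra_simps)
  finally have "p = N \<or> p = N\<^sup>2" by (simp add: add_eq_0_iff_eq)
  have bar: "ub ^ (2 ^ h) = u" by (simp add: ub_def frob_h_h)
  have bar_sq: "(x\<^sup>2) ^ (2 ^ h) = (x ^ (2 ^ h))\<^sup>2" for x :: 'a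
    by (simp add: power_mult[symmetric] mult.commute)
  have "ub = u\<^sup>2 \<and> u = ub\<^sup>2"
    using \<open>p = N \<or> p = N\<^sup>2\<close>
  proof
    assume "p = N"
    then have "u * u\<^sup>2 = u * ub" by (simp add: u(2) N_def power3_eq_cube power2_eq_square mult.commute)
    then have "ub = u\<^sup>2" using u(1) by simp
    then show ?thesis using bar bar_sq[of u] by (simp add: ub_def)
  next
    assume "p = N\<^sup>2"
    then have "u\<^sup>2 * u = u\<^sup>2 * ub\<^sup>2"
      by (simp add: u(2) N_def power3_eq_cube power2_eq_square ac_simps)
    then have "u = ub\<^sup>2" using u(1) by simp
    then show ?thesis using bar bar_sq[of ub] by (simp add: ub_def)
  qed
  then have "u = (u\<^sup>2)\<^sup>2" by metis
  also have "\<dots> = u * p" by (simp add: u(2) power3_eq_cube power2_eq_square)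
  finally have "p = 1" using u(1) by simp
  then have "q = 0" by (simp add: q)
  then show False using v by simp
qed

text \<open>Since \<open>D\<close> is a group and \<open>x ^ d\<close> is multiplicative, a word of
  weight 3 can be scaled to contain the coordinate 1.\<close>

lemma dual_weight_ge_4:
  assumes k1: "k = 1" and v: "v \<in> dual_code D C" "v \<noteq> 0"
  shows "4 \<le> weight v"
proof -
  note sums = v(1)[unfolded dual_code_iff]
  have "weight v \<noteq> 3"
  proof
    assume "weight v = 3"
    then obtain x y z where x: "{x. v x \<noteq> 0} = {x, y, z}" "x \<noteq> y" "y \<noteq> z" "x \<noteq> z"
      using dual_support(2)[OF v(1)] by (metis card_3_iff)
    then have D: "x \<in> D" "y \<in> D" "z \<in> D" using dual_support(1)[OF v(1)] by auto
    then have z: "z \<noteq> 0" using zero_notin_D by auto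
    have "x + (y + z) = 0" "x ^ d + (y ^ d + z ^ d) = 0"
      using sums x(2-4) unfolding x(1) by simp_all
    then have "x + y = z" "x ^ d + y ^ d = z ^ d"
      by (simp_all add: add.assoc[symmetric] add_eq_0_iff_eq)
    then have "x / z + y / z = 1" "(x / z) ^ d + (y / z) ^ d = 1"
      using z by (simp_all add: power_divide add_divide_distrib[symmetric])
    then show False using no_three_term_relation[OF k1] D_divide_closed D by blast
  qed
  then show ?thesis using dual_weight_ge_3[OF v] by linarith
qed

text \<open>The nonzero elements of the field of order \<open>2 ^ k\<close> lie in \<open>D\<close>,
  and \<open>x ^ d = x\<close> there, so both dual conditions become one. For \<open>k > 1\<close>
  this field has an element \<open>y\<close> outside \<open>{0, 1}\<close>, and 1, \<open>y\<close>,
  \<open>1 + y\<close> sum to 0.\<close>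

lemma dual_weight_3_word:
  assumes "k > 1"
  shows "\<exists>v\<in>dual_code D C. v \<noteq> 0 \<and> weight v = 3"
proof -
  let ?F = "{x::'a. x ^ (2 ^ k) = x}"
  have "card ?F = 2 ^ k" by (rule card_subfield[of _ "2 * r"]) (simp add: m_eq h_eq)
  moreover have "(2::nat) ^ 1 < 2 ^ k" using assms by (intro power_strict_increasing) auto
  ultimately have "card {0, 1::'a} < card ?F" by simp
  then have "\<not> ?F \<subseteq> {0, 1}" by (meson card_mono finite.intros leD)
  then have "\<exists>y. y \<in> ?F \<and> y \<notin> {0, 1}" by (simp only: subset_iff not_all not_imp)
  then obtain y where "y \<in> ?F" "y \<notin> {0, 1}" by blast
  then have y: "y ^ (2 ^ k) = y" "y \<noteq> 0" "y \<noteq> 1" by auto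
  have sub: "x \<in> D \<and> x ^ d = x" if x: "x ^ (2 ^ k) = x" "x \<noteq> 0" for x :: 'a
  proof -
    \<comment> \<open>The square root \<open>z\<close> stays in the subfield, where
      \<open>z ^ t = z\<^sup>2\<close> and \<open>z ^ (2 ^ h + 1) = z\<^sup>2\<close>.\<close>
    obtain z where z: "z ^ (2 ^ 1) = x" using frob_surj by blast
    have "z \<noteq> 0" using z x(2) by auto
    have "(z ^ (2 ^ k)) ^ (2 ^ 1) = z ^ (2 ^ 1)"
      using x(1) unfolding z[symmetric] by (simp add: power_mult[symmetric] mult.commute)
    then have zk: "z ^ (2 ^ k) = z" by (simp only: frob_eq_iff)
    then have zt: "z ^ t = x" using z by (simp add: t_eq power2_eq_square)
    have "z ^ (2 ^ h) = z" using frob_fixed_mult[OF zk] by (simp add: h_eq)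
    then have "x ^ d = x" using power_dt[OF \<open>z \<noteq> 0\<close>] z by (simp add: zt power2_eq_square)
    moreover have "x \<in> D" using \<open>z \<noteq> 0\<close> zt by (auto simp: D_eq)
    ultimately show ?thesis by blast
  qed
  let ?X = "{1, y, 1 + y}"
  have dist: "1 \<noteq> y" "1 + y \<noteq> 1" "1 + y \<noteq> y" using y by auto
  have X: "x \<in> D \<and> x ^ d = x" if "x \<in> ?X" for x
    using that sub[of 1] sub[OF y(1,2)] sub[of "1 + y"] y by (auto simp: frob_add add_eq_0_iff_eq)
  define v :: "'a \<Rightarrow> bit" where "v = (\<lambda>x. if x \<in> ?X then 1 else 0)"
  have supp: "{x. v x \<noteq> 0} = ?X" by (auto simp: v_def)
  have "v \<in> words D" using X by (auto simp: words_def v_def)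
  moreover have sum: "(\<Sum>x\<in>?X. x) = 0" using dist by (simp add: ac_simps)
  moreover have "(\<Sum>x\<in>?X. x ^ d) = (\<Sum>x\<in>?X. x)" using X by (intro sum.cong) auto
  ultimately have "v \<in> dual_code D C" unfolding dual_code_iff supp by simp
  moreover have "weight v = 3" unfolding weight_def supp using dist by simp
  moreover have "v 1 \<noteq> 0" by (simp add: v_def)
  then have "v \<noteq> 0" by auto
  ultimately show ?thesis by blast
qed

section \<open>Parameters and optimality of the dual code\<close>

lemma card_dual: "2 ^ (3 * h) * card (dual_code D C) = 2 ^ n"
  using card_dual_code[OF finite_D C_words subspace_C] by (simp add: card_C card_D)

lemma finite_dual: "finite (dual_code D C)"
  by (rule finite_subset[OF dual_code_subset_words finite_words[OF finite_D]])

lemma dim_dual: "3 * h + word.dim (dual_code D C) = n"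
proof -
  have "(2::nat) ^ (3 * h + word.dim (dual_code D C)) = 2 ^ n"
    using card_dual card_subspace_word[OF finite_dual subspace_dual_code] by (simp add: power_add)
  then show ?thesis by simp
qed

lemma binary_code_dual:
  assumes "has_min_dist (dual_code D C) \<delta>"
  shows "binary_code D n (n - 3 * h) \<delta> (dual_code D C)"
proof -
  have "word.dim (dual_code D C) = n - 3 * h" using dim_dual by linarith
  then show ?thesis
    unfolding binary_code_def
    using assms finite_D card_D dual_code_subset_words[of D C] subspace_dual_code[of D C] by blast
qed

text \<open>Distance 5 already gives balls of radius 2. With \<open>3 * n + 1 = Y\<^sup>2\<close>,
  18 times their size is \<open>Y ^ 4 + Y\<^sup>2 + 16\<close>, which exceeds
  \<open>18 * Y ^ 3\<close> once \<open>Y \<ge> 32\<close>; the redundancy leaves room for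
  \<open>Y ^ 3\<close> only.\<close>

lemma sphere_packing_fails:
  assumes "k = 1" "h \<ge> 5" "\<delta> \<ge> 5"
  shows "\<not> sphere_packing_bound n (n - 3 * h) \<delta>"
proof -
  define Y where "Y = (2::nat) ^ h"
  have "(2::nat) ^ 5 \<le> Y" unfolding Y_def using assms(2) by (intro power_increasing) auto
  then have Y: "Y \<ge> 32" by simp
  have n: "3 * n + 1 = Y\<^sup>2"
    using n_eq by (simp add: t_eq assms(1) Y_def m_eq power_mult[symmetric] mult.commute)
  have "Y ^ 3 < 1 + n + (n choose 2)"
  proof -
    have "even (n * (n - 1))" by (cases n) auto
    then have "2 * (n choose 2) = n * (n - 1)" by (simp add: choose_two)
    then have "2 * (n choose 2) + n = n * n" by (cases n) auto
    then have "18 * (1 + n + (n choose 2)) = (3 * n + 1) * (3 * n + 1) + (3 * n + 1) + 16"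
      by (simp add: algebra_simps)
    also have "\<dots> = Y * Y ^ 3 + Y\<^sup>2 + 16"
      unfolding n by (simp add: power2_eq_square power3_eq_cube)
    also have "\<dots> > 32 * Y ^ 3"
      using mult_le_mono1[OF Y, of "Y ^ 3"] by linarith
    finally have "32 * Y ^ 3 < 18 * (1 + n + (n choose 2))" .
    moreover have "18 * Y ^ 3 \<le> 32 * Y ^ 3" by simp
    ultimately have "18 * Y ^ 3 < 18 * (1 + n + (n choose 2))" by (rule le_less_trans[rotated])
    then show ?thesis by simp
  qed
  also have "1 + n + (n choose 2) = (\<Sum>i = 0..2. n choose i)"
    by (simp add: numeral_2_eq_2)
  also have "\<dots> \<le> (\<Sum>i = 0..(\<delta> - 1) div 2. n choose i)"
    using assms(3) by (intro sum_mono2) auto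
  finally have "2 ^ (n - 3 * h) * Y ^ 3 < 2 ^ (n - 3 * h) * (\<Sum>i = 0..(\<delta> - 1) div 2. n choose i)"
    by simp
  moreover have "2 ^ (n - 3 * h) * Y ^ 3 = 2 ^ n"
    using dim_dual by (simp add: Y_def mult.commute flip: power_mult power_add)
  ultimately show ?thesis by (simp add: sphere_packing_bound_def)
qed

lemma dual_ne_trivial:
  assumes "3 * h < n"
  shows "dual_code D C \<noteq> {0}"
proof
  assume "dual_code D C = {0}"
  then have "card (dual_code D C) = 1" by simp
  then show False using card_dual assms by simp
qed

text \<open>
  By the weight distribution, the fourth moment of the code has exactly the value it would have
  if no four distinct coordinates were dependent, so there is no dual word of weight 4.
\<close>

lemma dual_weight_ge_5:
  assumes k1: "k = 1" and h3: "h = 3" and v: "v \<in> dual_code D C" "v \<noteq> 0"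
  shows "5 \<le> weight v"
proof -
  have t3: "t = 3" by (simp add: t_eq k1)
  have m6: "m = 6" by (simp add: m_eq h3)
  have n21: "n = 21" using n_eq by (simp add: t3 m6)
  let ?F = "\<lambda>c. \<Sum>x\<in>D. chi (c x)"
  let ?T = "{(x, y, z, w). {x, y, z, w} \<subseteq> D \<and> (\<forall>c\<in>C. c x + c y + c z + c w = 0)}"
  have pw: "(2::int) ^ m = 64" "(2::int) ^ h = 8" "(2::int) ^ (h + k) = 16" "(2::int) ^ (h + 2 * k) = 32"
    by (simp_all add: m6 h3 k1)
  have freqs: "freq (- 8) = 280" "freq 16 = 210" "freq (- 32) = 21"
    using freq_values by (simp_all add: k1 h3)
  have "(\<Sum>c\<in>C. ?F c ^ 4) = (\<Sum>c\<in>C. ((exp_sum c - 1) div 3) ^ 4)"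
    unfolding exp_sum_def by (simp add: t3)
  \<comment> \<open>The character sums are 21, -3, 5 and -11 with multiplicities 1, 280, 210 and 21.
    The total equals 512 * (3 * 21 * 21 - 2 * 21), which is \<open>card C\<close> times the number
    of paired quadruples.\<close>
  also have "\<dots> = 655872"
    using sum_exp_sum_fun[of "\<lambda>s. ((s - 1) div 3) ^ 4"] unfolding pw freqs by simp
  also have "(\<Sum>c\<in>C. ?F c ^ 4) = int (card C) * int (card ?T)"
    by (rule fourth_moment[OF finite_D finite_C C_add])
  finally have "card ?T = card (paired D)"
    using card_paired[OF finite_D] by (simp add: card_C h3 card_D n21)
  moreover have "c x + c y + c z + c w = 0"
    if "x = y \<and> z = w \<or> x = z \<and> y = w \<or> x = w \<and> y = z" for x y z w and c :: "'a \<Rightarrow> bit"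
    using that by (cases "c x"; cases "c y"; cases "c z"; cases "c w") auto
  then have "paired D \<subseteq> ?T" unfolding paired_def by blast
  ultimately have T: "?T = paired D"
    using card_subset_eq[of ?T "paired D"] by simp
  have "weight v \<noteq> 4"
  proof
    assume "weight v = 4"
    then have "card {x. v x \<noteq> 0} = Suc 3" using dual_support(2)[OF v(1)] by simp
    then obtain x B where x: "{x. v x \<noteq> 0} = insert x B" "x \<notin> B" "card B = 3"
      by (metis card_Suc_eq)
    obtain y z w where B: "B = {y, z, w}" "y \<noteq> z" "y \<noteq> w" "z \<noteq> w"
      using x(3) by (metis card_3_iff)
    have "c x + c y + c z + c w = 0" if "c \<in> C" for c
    proof -
      have "inner D c v = 0" using v(1) that by (simp add: dual_code_def)
      moreover have "inner D c v = (\<Sum>i\<in>{x, y, z, w}. c i)"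
        using inner_support[OF finite_D, of v c] v(1) x(1) B(1) by (simp add: dual_code_def)
      ultimately show ?thesis using x(2) B by (simp add: add.assoc)
    qed
    moreover have "{x, y, z, w} \<subseteq> D" using dual_support(1)[OF v(1)] x(1) B(1) by simp
    ultimately have "(x, y, z, w) \<in> paired D" unfolding T[symmetric] by blast
    then show False using x(2) B by (auto simp: paired_def)
  qed
  then show ?thesis using dual_weight_ge_4[OF k1 v] by linarith
qed

end

text \<open>With \<open>h = k * r + s\<close> and \<open>2 ^ k\<close> equal to -1,
  \<open>2 ^ h + 1\<close> becomes \<open>2 ^ s * (- 1) ^ r + 1\<close> modulo
  \<open>2 ^ k + 1\<close>. As \<open>s < k\<close>, this is too small in absolute value to be a
  nonzero multiple, so it vanishes, which means \<open>r\<close> odd and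
  \<open>s = 0\<close>.\<close>

lemma two_power_plus_one_dvd:
  fixes k h :: nat
  assumes k: "k > 0" and dvd: "2 ^ k + 1 dvd (2 ^ h + 1 :: nat)"
  shows "k dvd h \<and> odd (h div k)"
proof -
  define r s where "r = h div k" and "s = h mod k"
  let ?t = "(2::int) ^ k + 1"
  have h: "h = k * r + s" by (simp add: r_def s_def)
  have "int (2 ^ k + 1) dvd int (2 ^ h + 1)" using dvd by (simp only: int_dvd_int_iff)
  then have 1: "?t dvd 2 ^ h + 1" by (simp add: add.commute)
  have "(2 ^ k - (- 1)) dvd ((2::int) ^ k) ^ r - (- 1) ^ r"
    by (simp only: diff_power_eq_sum power_diff_sumr2 dvd_triv_left)
  then have "?t dvd 2 ^ s * ((2 ^ k) ^ r - (- 1) ^ r)" by (simp add: dvd_mult)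
  with 1 have "?t dvd (2 ^ h + 1) - 2 ^ s * ((2 ^ k) ^ r - (- 1) ^ r)" by (rule dvd_diff)
  also have "(2 ^ h + 1) - 2 ^ s * ((2 ^ k) ^ r - (- 1) ^ r) = 2 ^ s * (- 1) ^ r + (1::int)"
    by (simp add: h power_add power_mult algebra_simps)
  finally have 2: "?t dvd 2 ^ s * (- 1) ^ r + 1" .
  have "s < k" using k by (simp add: s_def)
  then have s: "(2::int) ^ s < 2 ^ k" by simp
  have "odd r"
  proof
    assume "even r"
    then have "?t dvd 2 ^ s + 1" using 2 by simp
    moreover have "(0::int) < 2 ^ s + 1" by (simp add: add_pos_pos)
    ultimately have "?t \<le> 2 ^ s + 1" by (rule zdvd_imp_le)
    then show False using s by simp
  qed
  then have "?t dvd - (2 ^ s * (- 1) ^ r + 1)" using 2 by (simp only: dvd_minus_iff)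
  then have 3: "?t dvd 2 ^ s - 1" using \<open>odd r\<close> by simp
  have "s = 0"
  proof (rule ccontr)
    assume "s \<noteq> 0"
    then have "(0::int) < 2 ^ s - 1" using one_less_power[of "2::int" s] by simp
    with 3 have "?t \<le> 2 ^ s - 1" by (rule zdvd_imp_le)
    then show False using s by simp
  qed
  then show ?thesis using \<open>odd r\<close> by (auto simp: s_def r_def)
qed

lemma cyclic_subgroup_power:
  fixes \<gamma> :: "'a::field"
  assumes "primitive_element \<gamma>"
  shows "cyclic_subgroup (\<gamma> ^ t) = {x. \<exists>y. y \<noteq> 0 \<and> x = y ^ t}"
proof -
  have pw: "(\<gamma> ^ t) powi i = (\<gamma> powi i) ^ t" for i
    by (simp add: power_int_power power_int_power' mult.commute)
  have "cyclic_subgroup (\<gamma> ^ t) = (\<lambda>y. y ^ t) ` cyclic_subgroup \<gamma>"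
    by (simp add: cyclic_subgroup_def pw image_image)
  then show ?thesis using assms by (auto simp: primitive_element_def)
qed

theorem theorem5p5:
  fixes m k t d n :: nat
    and \<gamma> :: "'a::finite_field"
    and D :: "'a set"
    and C :: "('a \<Rightarrow> bit) set"
    and w1 w2 w3 :: real
  assumes "m \<ge> 4" and "even m"
    and "CARD('a) = 2 ^ m"
    and "k > 0" and "k \<noteq> m div 2"
    and "t = 2 ^ k + 1" and "t dvd 2 ^ m - 1"
    and "d > 0" and "[d * (2 ^ k + 1) = 2 ^ (m div 2) + 1] (mod (2 ^ m - 1))"
    and "primitive_element \<gamma>"
    and "D = cyclic_subgroup (\<gamma> ^ t)"
    and "C = trace_code m (\<lambda>x. x ^ d) D"
    and "n = (2 ^ m - 1) div t"
    and "w1 = (2 ^ (m - 1) + 2 ^ (m div 2 - 1)) / real t"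
    and "w2 = (2 ^ (m - 1) - 2 ^ (m div 2 + k - 1)) / real t"
    and "w3 = (2 ^ (m - 1) + 2 ^ (m div 2 + 2 * k - 1)) / real t"
  shows "(\<exists>\<delta>. real \<delta> = w2 \<and> binary_code D n (3 * m div 2) \<delta> C)
    \<and> distinct [0, w1, w2, w3]
    \<and> (\<forall>c\<in>C. real (weight c) \<in> {0, w1, w2, w3})
    \<and> weight_multiplicity C 0 = 1
    \<and> real (weight_multiplicity C w1) =
        2 ^ (3 * k) * (2 ^ (m div 2) - 1)
          * (2 ^ m - 2 powi (int m - 2 * int k) - 2 powi (int m - 3 * int k)
             + 2 ^ (m div 2) - 2 powi (int (m div 2) - int k) + 1)
        / ((real t)\<^sup>2 * (2 ^ k - 1))
    \<and> real (weight_multiplicity C w2) =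
        2 ^ k * (2 ^ m - 1)
          * (2 ^ (m div 2) + 2 powi (int (m div 2) - int k)
             + 2 powi (int (m div 2) - 2 * int k) + 1)
        / (real t)\<^sup>2
    \<and> real (weight_multiplicity C w3) =
        (2 powi (int (m div 2) - int k) - 1) * (2 ^ m - 1)
        / ((real t)\<^sup>2 * (2 ^ k - 1))
    \<and> (k > 1 \<longrightarrow> binary_code D n (n - 3 * m div 2) 3 (dual_code D C))
    \<and> (k = 1 \<and> m \<noteq> 6 \<longrightarrow>
         binary_code D n (n - 3 * m div 2) 4 (dual_code D C)
         \<and> distance_optimal_sphere_packing n (n - 3 * m div 2) 4)
    \<and> (k = 1 \<and> m = 6 \<longrightarrow>
         binary_code D 21 12 5 (dual_code D C)
         \<and> distance_optimal 21 12 5)"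
proof -
  define h r where "h = m div 2" and "r = h div k"
  have m: "m = 2 * h" using assms(2) by (simp add: h_def)
  have t_dvd: "t dvd 2 ^ h + 1"
  proof -
    have "[d * t = 2 ^ h + 1] (mod t)"
      using cong_dvd_modulus_nat[OF assms(9,7)[folded assms(6) h_def]] by (simp add: assms(6) h_def)
    then show ?thesis by (simp add: cong_def mod_eq_0_iff_dvd)
  qed
  have "k dvd h \<and> odd r"
    unfolding r_def using two_power_plus_one_dvd[OF assms(4)] t_dvd by (simp add: assms(6))
  then have h: "h = k * r" and r: "odd r" by (auto simp: r_def)
  have "r \<noteq> 1" using h assms(5) by (auto simp: h_def)
  then have r3: "r \<ge> 3" using r by (cases r; cases "r - 1"; cases "r - 2") auto
  interpret S: trace_code_setting m "TYPE('a)" h k r t d n D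
  proof
    show "t * n = 2 ^ m - 1" using assms(7) by (simp add: assms(13))
    show "[d * t = 2 ^ h + 1] (mod (2 ^ m - 1))" using assms(9) by (simp add: assms(6) h_def)
    show "D = {x. \<exists>y. y \<noteq> 0 \<and> x = y ^ t}"
      unfolding assms(11) by (rule cyclic_subgroup_power[OF assms(10)])
  qed (use assms m h r r3 t_dvd in auto)
  have C: "C = S.C" by (simp add: assms(12) S.C_def)
  define X K where "X = (2::real) ^ h" and "K = (2::real) ^ k"
  have K: "K \<ge> 2" using power_increasing[of 1 k "2::real"] assms(4) by (simp add: K_def)
  have KX: "K ^ 3 \<le> X"
    unfolding X_def K_def power_mult[symmetric]
    using S.h_ge by (intro power_increasing) (auto simp: mult.commute)
  have tK: "real t = K + 1" by (simp add: assms(6) K_def)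
  have h_pos: "h > 0" using assms(1) by (simp add: h_def)
  have "(2::real) ^ m = 2 * 2 ^ (m - 1)" using assms(1) by (cases m) auto
  moreover have "(2::real) ^ h = 2 * 2 ^ (h - 1)" using h_pos by (cases h) auto
  moreover have "(2::real) ^ (h + k) = 2 * 2 ^ (h + k - 1)" using h_pos by (cases h) auto
  moreover have "(2::real) ^ (h + 2 * k) = 2 * 2 ^ (h + 2 * k - 1)" using h_pos by (cases h) auto
  \<comment> \<open>Doubling numerator and denominator brings each weight to the form
    \<open>(2 ^ m - s) / (2 * t)\<close>, with \<open>s\<close> the corresponding value of
    \<open>exp_sum\<close>.\<close>
  ultimately have w: "w1 = (2 ^ m - of_int (- (2 ^ h))) / (2 * real t)"
    "w2 = (2 ^ m - of_int (2 ^ (h + k))) / (2 * real t)"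
    "w3 = (2 ^ m - of_int (- (2 ^ (h + 2 * k)))) / (2 * real t)"
    using S.t_ge by (simp_all add: assms(14-16) h_def[symmetric] field_simps)
  have pw: "(2::real) ^ m = X\<^sup>2" "(2::real) ^ h = X" "(2::real) ^ (h + k) = X * K"
      "(2::real) ^ (h + 2 * k) = X * K\<^sup>2"
    by (simp_all add: X_def K_def m power_add power_mult[symmetric] mult.commute)
  have wX: "w1 = (X\<^sup>2 + X) / (2 * real t)" "w2 = (X\<^sup>2 - X * K) / (2 * real t)"
    "w3 = (X\<^sup>2 + X * K\<^sup>2) / (2 * real t)"
    unfolding w by (simp_all add: pw)
  have K2: "1 < K\<^sup>2" using K by (intro one_less_power) auto
  then have "K * 1 < K * K\<^sup>2" using K by (intro mult_strict_left_mono) auto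
  then have K_less_X: "K < X" using KX by (simp add: power3_eq_cube power2_eq_square)
  have X_pos: "X > 0" and t_pos: "real t > 0" using K_less_X K tK by auto
  have w_less: "0 < w2" "w2 < w1" "w1 < w3"
  proof -
    have "X * K < X * X" using K_less_X X_pos by simp
    then show "0 < w2" using t_pos by (simp add: wX power2_eq_square)
    have "0 < X * K" using X_pos K by simp
    then show "w2 < w1" using t_pos X_pos unfolding wX by (intro divide_strict_right_mono) auto
    have "X * 1 < X * K\<^sup>2" using X_pos K2 by (intro mult_strict_left_mono) auto
    then show "w1 < w3" using t_pos unfolding wX by (intro divide_strict_right_mono) auto
  qed
  have weights: "real (weight c) \<in> {w1, w2, w3}" if "c \<in> C" "c \<noteq> 0" for c
    unfolding w using S.exp_sum_nonzero_codeword[of c] S.weight_eq_iff[of c] that unfolding C by blast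
  have weight_0: "weight (0 :: 'a \<Rightarrow> bit) = 0" by (simp add: weight_def)
  have all_weights: "\<forall>c\<in>C. real (weight c) \<in> {0, w1, w2, w3}"
    using weights weight_0 by fastforce
  have mult_0: "weight_multiplicity C 0 = 1"
  proof -
    have "{c \<in> C. real (weight c) = 0} = {0}"
      using weights weight_0 w_less S.zero_in_C unfolding C by fastforce
    then show ?thesis by (simp add: weight_multiplicity_def)
  qed
  have freqs: "real (weight_multiplicity C w1) * ((K - 1) * (K + 1)\<^sup>2) =
      (X - 1) * (K ^ 3 * X\<^sup>2 - K * X\<^sup>2 - X\<^sup>2 + K ^ 3 * X - K\<^sup>2 * X + K ^ 3)"
    "real (weight_multiplicity C w2) * (K * (K + 1)\<^sup>2) = (X\<^sup>2 - 1) * (X * (1 + K + K\<^sup>2) + K\<^sup>2)"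
    "real (weight_multiplicity C w3) * (K * (K - 1) * (K + 1)\<^sup>2) = (X\<^sup>2 - 1) * (X - K)"
    using S.freq_values[THEN arg_cong[where f = real_of_int]]
    unfolding w C S.weight_multiplicity_eq_freq X_def K_def by simp_all
  have nz: "K \<noteq> 0" "K - 1 \<noteq> 0" "K + 1 \<noteq> 0" using K by auto
  have powi: "2 powi (int m - 2 * int k) = X\<^sup>2 / K\<^sup>2" "2 powi (int m - 3 * int k) = X\<^sup>2 / K ^ 3"
    "2 powi (int h - int k) = X / K" "2 powi (int h - 2 * int k) = X / K\<^sup>2"
  proof -
    have P: "2 powi (int a - int b) = (2::real) ^ a / 2 ^ b" for a b
      by (simp add: power_int_diff)
    show "2 powi (int m - 2 * int k) = X\<^sup>2 / K\<^sup>2"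
      using P[of m "2 * k"] by (simp add: pw(1)[symmetric] K_def power_mult[symmetric] mult.commute)
    show "2 powi (int m - 3 * int k) = X\<^sup>2 / K ^ 3"
      using P[of m "3 * k"] by (simp add: pw(1)[symmetric] K_def power_mult[symmetric] mult.commute)
    show "2 powi (int h - int k) = X / K"
      using P[of h k] by (simp add: X_def K_def)
    show "2 powi (int h - 2 * int k) = X / K\<^sup>2"
      using P[of h "2 * k"] by (simp add: X_def K_def power_mult[symmetric] mult.commute)
  qed
  have pK: "2 ^ (3 * k) = K ^ 3" "2 ^ k = K"
    by (simp_all add: K_def power_mult[symmetric] mult.commute)
  have m1: "real (weight_multiplicity C w1) =
      K ^ 3 * (X - 1) * (X\<^sup>2 - X\<^sup>2 / K\<^sup>2 - X\<^sup>2 / K ^ 3 + X - X / K + 1) / ((real t)\<^sup>2 * (K - 1))"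
  proof -
    have "K ^ 3 * (X\<^sup>2 - X\<^sup>2 / K\<^sup>2 - X\<^sup>2 / K ^ 3 + X - X / K + 1) =
        K ^ 3 * X\<^sup>2 - K * X\<^sup>2 - X\<^sup>2 + K ^ 3 * X - K\<^sup>2 * X + K ^ 3"
      using nz(1) by (simp add: field_simps power2_eq_square power3_eq_cube)
    then have "K ^ 3 * (X - 1) * (X\<^sup>2 - X\<^sup>2 / K\<^sup>2 - X\<^sup>2 / K ^ 3 + X - X / K + 1) =
        real (weight_multiplicity C w1) * ((K - 1) * (K + 1)\<^sup>2)"
      unfolding freqs(1) by (simp only: ac_simps)
    then show ?thesis using nz by (simp add: tK)
  qed
  have m2: "real (weight_multiplicity C w2) =
      K * (X\<^sup>2 - 1) * (X + X / K + X / K\<^sup>2 + 1) / (real t)\<^sup>2"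
  proof -
    have "K\<^sup>2 * (X + X / K + X / K\<^sup>2 + 1) = X * (1 + K + K\<^sup>2) + K\<^sup>2"
      using nz(1) by (simp add: field_simps power2_eq_square)
    moreover have "K * (K * (X\<^sup>2 - 1) * (X + X / K + X / K\<^sup>2 + 1)) =
        (X\<^sup>2 - 1) * (K\<^sup>2 * (X + X / K + X / K\<^sup>2 + 1))"
      by (simp only: power2_eq_square[of K] ac_simps)
    ultimately have "K * (K * (X\<^sup>2 - 1) * (X + X / K + X / K\<^sup>2 + 1)) =
        K * (real (weight_multiplicity C w2) * (K + 1)\<^sup>2)"
      using freqs(2) by (simp add: mult.left_commute)
    then show ?thesis using nz by (simp add: tK)
  qed
  have m3: "real (weight_multiplicity C w3) =
      (X / K - 1) * (X\<^sup>2 - 1) / ((real t)\<^sup>2 * (K - 1))"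
  proof -
    have "K * (X / K - 1) = X - K" using nz(1) by (simp add: field_simps)
    moreover have "K * ((X / K - 1) * (X\<^sup>2 - 1)) = (X\<^sup>2 - 1) * (K * (X / K - 1))"
      by (simp only: ac_simps)
    ultimately have "K * ((X / K - 1) * (X\<^sup>2 - 1)) = K * (real (weight_multiplicity C w3) * ((K - 1) * (K + 1)\<^sup>2))"
      using freqs(3) by (simp only: ac_simps)
    then show ?thesis using nz by (simp add: tK mult.commute)
  qed
  \<comment> \<open>Positivity shows that the smallest candidate weight occurs and is the minimum
    distance.\<close>
  have "0 < real (weight_multiplicity C w2)"
  proof -
    have "1 < X\<^sup>2" using K_less_X K by (intro one_less_power) auto
    then show ?thesis unfolding m2 using K X_pos t_pos by (intro divide_pos_pos mult_pos_pos add_pos_pos) auto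
  qed
  then have "card {c \<in> C. real (weight c) = w2} > 0" by (simp add: weight_multiplicity_def)
  then have "{c \<in> C. real (weight c) = w2} \<noteq> {}" unfolding card_gt_0_iff by (rule conjunct1)
  then obtain c where c: "c \<in> C" "real (weight c) = w2" by blast
  have min_dist: "has_min_dist C (weight c)"
    unfolding C has_min_dist_subspace[OF S.subspace_C]
  proof (intro conjI ballI impI)
    have "c \<noteq> 0" using c(2) w_less(1) weight_0 by auto
    then show "\<exists>c'\<in>S.C. c' \<noteq> 0 \<and> weight c' = weight c" using c(1) C by blast
    fix c' assume "c' \<in> S.C" "c' \<noteq> 0"
    then have "w2 \<le> real (weight c')" using weights[of c'] w_less C by auto
    then show "weight c \<le> weight c'" using c(2) by simp
  qed
  have hm: "3 * m div 2 = 3 * h" by (simp add: m)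
  have code: "\<exists>\<delta>. real \<delta> = w2 \<and> binary_code D n (3 * m div 2) \<delta> C"
    using min_dist c(2) S.finite_D S.card_D S.C_words S.subspace_C S.dim_C
    unfolding hm binary_code_def C by blast
  have dual_3: "binary_code D n (n - 3 * h) 3 (dual_code D C)" if "k > 1"
    unfolding C
    using S.dual_weight_3_word[OF that] S.dual_weight_ge_3
    by (intro S.binary_code_dual) (simp add: has_min_dist_subspace subspace_dual_code)
  have dual_4: "binary_code D n (n - 3 * h) 4 (dual_code D C) \<and> distance_optimal_sphere_packing n (n - 3 * h) 4"
    if "k = 1" "m \<noteq> 6"
  proof -
    \<comment> \<open>For \<open>k = 1\<close> the quotient \<open>r\<close> is \<open>h\<close>
      itself, so \<open>h\<close> is odd and the next case after the excluded 3 is 5.\<close>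
    have "h \<noteq> 3" "odd h" using that m h r by auto
    moreover have "h \<ge> 3" using S.h_ge that by simp
    ultimately have h5: "h \<ge> 5" by presburger
    have sp: "\<not> sphere_packing_bound n (n - 3 * h) \<delta>" if "\<delta> \<ge> 5" for \<delta>
      by (rule S.sphere_packing_fails[OF \<open>k = 1\<close> h5 that])
    \<comment> \<open>Keeps the dual from being zero, in which case it would have no minimum
      distance.\<close>
    have "n \<noteq> 3 * h"
    proof
      assume "n = 3 * h"
      then have "3 * (3 * h) = 2 ^ m - 1" using S.n_eq that(1) by (simp add: assms(6))
      moreover have "9 * h + 1 < 2 ^ (2 * h)" using h5
        by (induction h rule: dec_induct) auto
      ultimately show False by (simp add: m)
    qed
    then obtain \<delta> where \<delta>: "has_min_dist (dual_code D S.C) \<delta>"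
      using exists_min_dist[OF subspace_dual_code S.dual_ne_trivial] S.dim_dual by fastforce
    then have "4 \<le> \<delta>"
      using S.dual_weight_ge_4[OF that(1)] by (auto simp: has_min_dist_subspace subspace_dual_code)
    \<comment> \<open>The bound that gives optimality also caps the distance of the dual itself, so
      a word of weight 4 must exist.\<close>
    moreover have "\<delta> < 5"
      using sp[of \<delta>] sphere_packing_boundI[OF S.binary_code_dual[OF \<delta>]] by linarith
    ultimately have "\<delta> = 4" by simp
    moreover have "distance_optimal n (n - 3 * h) 4"
      unfolding distance_optimal_def using sp sphere_packing_boundI by fastforce
    ultimately show ?thesis
      using S.binary_code_dual[OF \<delta>] sp by (simp add: distance_optimal_sphere_packing_def C)
  qed
  have dual_5: "binary_code D 21 12 5 (dual_code D C)" if "k = 1" "m = 6"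
  proof -
    have h3: "h = 3" using that m by simp
    have "3 * n = 63" using S.n_eq that by (simp add: assms(6))
    then have n: "n = 21" by simp
    obtain \<delta> where \<delta>: "has_min_dist (dual_code D S.C) \<delta>"
      using exists_min_dist[OF subspace_dual_code S.dual_ne_trivial] n h3 by fastforce
    have "5 \<le> \<delta>"
      using \<delta> S.dual_weight_ge_5[OF that(1) h3] by (auto simp: has_min_dist_subspace subspace_dual_code)
    have code: "binary_code D 21 12 \<delta> (dual_code D C)"
      using S.binary_code_dual[OF \<delta>] by (simp add: n h3 C)
    then have "\<delta> < 6" by (rule no_code_21_12_6)
    then have "\<delta> = 5" using \<open>5 \<le> \<delta>\<close> by linarith
    then show ?thesis using code by simp
  qed
  show ?thesis
    using code w_less all_weights mult_0 m1 m2 m3 dual_3 dual_4 dual_5 distance_optimal_21_12_5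
    unfolding hm h_def[symmetric] powi pK pw by simp
qed

end
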